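(* Let $(\xi_l)_{l\ge0}$ be a subordinator with Laplace–Bernstein exponent $\Phi\not\equiv0$, let $\mathcal I=\int_0^\infty e^{-\xi_l}\mathrm dl$, $I(r)=\mathbb E[\mathcal I^{r-1}]$, and let $\kappa$ be the measure on $\mathbb R_+$ whose Laplace transform is $\Phi'/\Phi$. Then for all $r>0$, \[ I(r)=\Gamma(r)\,\Phi(1)^{-r+1}\exp\Bigl[-\int_{(0,+\infty)}\frac{e^{-(r-1)x}-1-(r-1)(e^{-x}-1)}{x\,(e^x-1)}\,\kappa(\mathrm dx)\Bigr]. \]
   Context: $\Phi$ is defined by $\mathbb E[e^{-s\xi_l}]=e^{-l\Phi(s)}$ for $l,s\ge0$; $\kappa$ is the measure on $[0,\infty)$ with $\int e^{-sx}\kappa(\mathrm dx)=\Phi'(s)/\Phi(s)$ for $s>0$. $\Gamma$ is Euler's Gamma function. *)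

theory Defs
  imports "HOL-Probability.Probability"
begin

definition subordinator :: "'a measure \<Rightarrow> (real \<Rightarrow> 'a \<Rightarrow> real) \<Rightarrow> bool" where
  "subordinator M \<xi> \<longleftrightarrow>
     prob_space M \<and>
     (\<forall>t\<ge>0. \<xi> t \<in> borel_measurable M) \<and>
     (\<forall>\<omega>\<in>space M. \<xi> 0 \<omega> = 0 \<and> mono_on {0..} (\<lambda>t. \<xi> t \<omega>) \<and>
        (\<forall>t\<ge>0. continuous (at_right t) (\<lambda>s. \<xi> s \<omega>))) \<and>
     (\<forall>(ts :: nat \<Rightarrow> real) n. 0 \<le> ts 0 \<and> incseq ts \<longrightarrow>
        prob_space.indep_vars M (\<lambda>_. borel) (\<lambda>i \<omega>. \<xi> (ts (Suc i)) \<omega> - \<xi> (ts i) \<omega>) {..<n}) \<and>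
     (\<forall>s\<ge>0. \<forall>t\<ge>0. distr M borel (\<lambda>\<omega>. \<xi> (s + t) \<omega> - \<xi> s \<omega>) = distr M borel (\<xi> t))"

definition expfun :: "(real \<Rightarrow> 'a \<Rightarrow> real) \<Rightarrow> 'a \<Rightarrow> real" where
  "expfun \<xi> \<omega> = enn2real (\<integral>\<^sup>+ l. ennreal (exp (- \<xi> l \<omega>)) * indicator {0..} l \<partial>lborel)"

end

theory Submission
  imports Defs
begin

text \<open>Put \<open>A s = \<integral>\<^bsub>s\<^esub>\<^bsup>\<infinity>\<^esup> exp (- \<xi> l) dl\<close>, so that \<open>A 0\<close> is the exponential functional. Pathwise,
  \<open>A 0 powr r = r * \<integral> exp (- \<xi> s) * A s powr (r - 1) ds\<close>. Since \<open>A s\<close> is \<open>exp (- \<xi> s)\<close> times a copy of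
  \<open>A 0\<close> independent of \<open>\<xi> s\<close>, taking expectations gives \<open>I (r + 1) = r / \<Phi> r * I r\<close>. Let \<open>K r\<close> be the
  integral against \<open>\<kappa>\<close> in the exponent; Frullani's formula for \<open>ln (\<Phi> r) - ln (\<Phi> 1)\<close> turns into
  \<open>exp (K (r + 1)) = \<Phi> r / \<Phi> 1 * exp (K r)\<close>. Both \<open>I\<close> and \<open>exp \<circ> K\<close> are log-convex, so
  \<open>I r * \<Phi> 1 powr (r - 1) * exp (K r)\<close> is \<open>Gamma r\<close> by the Bohr--Mollerup theorem.\<close>

subsection \<open>Laplace exponents, independence and moments\<close>

text \<open>Independence is given only for finitely many increments, while the copy of
  \<open>A 0\<close> depends on the whole path after \<open>s\<close>. It is therefore reached
  through Riemann sums that stay below the integral; the limit is taken inside indicators of open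
  rays, and rays determine the law. For \<open>r < 1\<close> the powers of the functional are
  negative, and their finiteness is not visible in advance. Hence the moment recurrence is proved
  for extended nonnegative integrals and then read in both directions: upward from exponent 0
  through the integers, and downward from exponent \<open>r\<close> to \<open>r - 1\<close>.
  Restricting the \<kappa>-integral to positive \<open>x\<close> loses nothing: a Laplace exponent
  satisfies \<open>s * \<Phi>' s \<le> \<Phi> s\<close>, so the transform of \<kappa> tends to 0 at
  infinity and \<kappa> has no atom at the origin.\<close>

lemma abs_exp_minus_one_le: "\<bar>exp u - 1\<bar> \<le> \<bar>u\<bar> * exp \<bar>u\<bar>" for u :: real
proof (cases "u \<ge> 0")
  case True
  have "exp u * (1 - u) \<le> exp u * exp (- u)"
    using exp_ge_add_one_self[of "- u"] by (intro mult_left_mono) auto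
  then show ?thesis using True by (simp add: algebra_simps flip: exp_add)
next
  case False
  have "1 - exp u \<le> - u * 1" using exp_ge_add_one_self[of u] by linarith
  also have "\<dots> \<le> - u * exp (- u)" using False by (intro mult_left_mono) auto
  finally show ?thesis using False by simp
qed

lemma mult_exp_neg_le:
  fixes x s :: real
  assumes "0 < s"
  shows "x * exp (- s * x) \<le> 1 / s"
proof -
  have "s * x * exp (- s * x) \<le> exp (s * x) * exp (- s * x)"
    using exp_ge_add_one_self[of "s * x"] by (intro mult_right_mono) (linarith, simp)
  then show ?thesis using assms by (simp add: field_simps flip: exp_add)
qed

context prob_space
begin

lemma integrable_exp_neg:
  fixes X :: "'a \<Rightarrow> real"
  assumes [measurable]: "X \<in> borel_measurable M" and "\<And>\<omega>. \<omega> \<in> space M \<Longrightarrow> 0 \<le> X \<omega>" "0 \<le> s"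
  shows "integrable M (\<lambda>\<omega>. exp (- s * X \<omega>))"
  by (rule integrable_const_bound[where B = 1]) (use assms in auto)

text \<open>Differentiation under the expectation works although \<open>X\<close> may have infinite
  mean, because \<open>s > 0\<close>: half of the decay of \<open>exp (- s * X)\<close> absorbs the
  growth of the difference quotient, and the other half bounds the remaining factor
  \<open>X\<close>.\<close>

lemma has_derivative_laplace_transform:
  fixes X :: "'a \<Rightarrow> real"
  assumes [measurable]: "X \<in> borel_measurable M"
    and nonneg: "\<And>\<omega>. \<omega> \<in> space M \<Longrightarrow> 0 \<le> X \<omega>" and s: "0 < s"
  shows "((\<lambda>s. expectation (\<lambda>\<omega>. exp (- s * X \<omega>))) has_real_derivative
    - expectation (\<lambda>\<omega>. X \<omega> * exp (- s * X \<omega>))) (at s)"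
proof -
  let ?f = "\<lambda>s. expectation (\<lambda>\<omega>. exp (- s * X \<omega>))"
  have "(\<lambda>n. (?f (s + S n) - ?f s) / S n) \<longlonglongrightarrow> - expectation (\<lambda>\<omega>. X \<omega> * exp (- s * X \<omega>))"
    if S0: "\<And>n. S n \<noteq> 0" and S: "S \<longlonglongrightarrow> 0" for S
  proof -
    obtain N where N: "\<And>n. n \<ge> N \<Longrightarrow> \<bar>S n\<bar> < s / 2"
      using tendstoD[OF S, of "s / 2"] s by (auto simp: eventually_sequentially)
    define h where "h n = S (n + N)" for n
    have h: "h n \<noteq> 0" "\<bar>h n\<bar> < s / 2" for n using N[of "n + N"] S0 by (auto simp: h_def)
    have h_lim: "h \<longlonglongrightarrow> 0" unfolding h_def using S by (rule LIMSEQ_ignore_initial_segment)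
    have "(\<lambda>n. expectation (\<lambda>\<omega>. (exp (- (s + h n) * X \<omega>) - exp (- s * X \<omega>)) / h n))
        \<longlonglongrightarrow> expectation (\<lambda>\<omega>. - (X \<omega> * exp (- s * X \<omega>)))"
    \<comment> \<open>The constant is the bound \<open>1 / s\<close> of
      \<open>mult_exp_neg_le\<close> taken at \<open>s / 2\<close>, the decay that remains once
      \<open>\<bar>h n\<bar> < s / 2\<close>.\<close>
    proof (rule integral_dominated_convergence[where w = "\<lambda>_. 2 / s"])
      show "AE \<omega> in M. (\<lambda>n. (exp (- (s + h n) * X \<omega>) - exp (- s * X \<omega>)) / h n)
          \<longlonglongrightarrow> - (X \<omega> * exp (- s * X \<omega>))"
      proof (rule AE_I2)
        fix \<omega>
        have "((\<lambda>s. exp (- s * X \<omega>)) has_real_derivative - (X \<omega> * exp (- s * X \<omega>))) (at s)"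
          by (auto intro!: derivative_eq_intros)
        then have "(\<lambda>h. (exp (- (s + h) * X \<omega>) - exp (- s * X \<omega>)) / h) \<midarrow>0\<rightarrow> - (X \<omega> * exp (- s * X \<omega>))"
          unfolding DERIV_def .
        then show "(\<lambda>n. (exp (- (s + h n) * X \<omega>) - exp (- s * X \<omega>)) / h n)
            \<longlonglongrightarrow> - (X \<omega> * exp (- s * X \<omega>))"
          using h h_lim unfolding LIMSEQ_SEQ_conv[symmetric] by blast
      qed
      show "AE \<omega> in M. norm ((exp (- (s + h n) * X \<omega>) - exp (- s * X \<omega>)) / h n) \<le> 2 / s" for n
      proof (rule AE_I2)
        fix \<omega> assume "\<omega> \<in> space M"
        note x = nonneg[OF this]
        have "exp (- (s + h n) * X \<omega>) - exp (- s * X \<omega>) = exp (- s * X \<omega>) * (exp (- (h n * X \<omega>)) - 1)"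
          by (simp add: algebra_simps flip: exp_add)
        then have "\<bar>exp (- (s + h n) * X \<omega>) - exp (- s * X \<omega>)\<bar> = exp (- s * X \<omega>) * \<bar>exp (- (h n * X \<omega>)) - 1\<bar>"
          by (simp only: abs_mult abs_exp_cancel)
        also have "\<dots> \<le> exp (- s * X \<omega>) * (\<bar>- (h n * X \<omega>)\<bar> * exp \<bar>- (h n * X \<omega>)\<bar>)"
          by (intro mult_left_mono abs_exp_minus_one_le) auto
        also have "\<dots> = \<bar>h n\<bar> * (X \<omega> * exp ((\<bar>h n\<bar> - s) * X \<omega>))"
          using x by (simp add: abs_mult algebra_simps flip: exp_add)
        also have "\<dots> \<le> \<bar>h n\<bar> * (X \<omega> * exp (- (s / 2) * X \<omega>))"
          using mult_right_mono[of "\<bar>h n\<bar> - s" "- (s / 2)", OF _ x] h(2)[of n] x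
          by (intro mult_left_mono) auto
        also have "\<dots> \<le> \<bar>h n\<bar> * (1 / (s / 2))"
          using s by (intro mult_left_mono mult_exp_neg_le) auto
        finally show "norm ((exp (- (s + h n) * X \<omega>) - exp (- s * X \<omega>)) / h n) \<le> 2 / s"
          using h(1)[of n] by (simp add: abs_divide divide_le_eq mult.commute)
      qed
    qed auto
    moreover have "expectation (\<lambda>\<omega>. (exp (- (s + h n) * X \<omega>) - exp (- s * X \<omega>)) / h n)
        = (?f (s + h n) - ?f s) / h n" for n
    proof -
      have "0 \<le> s + h n" using h(2)[of n] s by auto
      then show ?thesis
        using integrable_exp_neg[OF assms(1) nonneg, of "s + h n"] integrable_exp_neg[OF assms(1) nonneg, of s] s
        by simp
    qed
    ultimately have "(\<lambda>n. (?f (s + h n) - ?f s) / h n) \<longlonglongrightarrow> - expectation (\<lambda>\<omega>. X \<omega> * exp (- s * X \<omega>))"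
      by (simp only: Bochner_Integration.integral_minus)
    then show ?thesis unfolding h_def by (rule LIMSEQ_offset)
  qed
  then show ?thesis unfolding DERIV_def LIMSEQ_SEQ_conv[symmetric] by blast
qed

text \<open>The exponent is minus the logarithm of the transform, which gives the derivative. The
  last bound is what concavity together with the value 0 at 0 would give; it comes from integrating
  a pointwise inequality, without a second derivative.\<close>

lemma laplace_exponent:
  fixes X :: "'a \<Rightarrow> real" and \<phi> :: "real \<Rightarrow> real"
  assumes X[measurable]: "X \<in> borel_measurable M"
    and nonneg: "\<And>\<omega>. \<omega> \<in> space M \<Longrightarrow> 0 \<le> X \<omega>"
    and LT: "\<And>s. 0 \<le> s \<Longrightarrow> expectation (\<lambda>\<omega>. exp (- s * X \<omega>)) = exp (- \<phi> s)"
    and nz: "0 \<le> q" "\<phi> q \<noteq> 0"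
    and s: "0 < s"
  shows laplace_exponent_pos: "0 < \<phi> s"
    and laplace_exponent_deriv: "(\<phi> has_real_derivative deriv \<phi> s) (at s)"
    and laplace_exponent_deriv_nonneg: "0 \<le> deriv \<phi> s"
    and laplace_exponent_deriv_le: "s * deriv \<phi> s \<le> \<phi> s"
proof -
  note int = integrable_exp_neg[OF X nonneg]
  define D where "D = expectation (\<lambda>\<omega>. X \<omega> * exp (- s * X \<omega>))"
  have \<phi>_eq: "\<phi> t = - ln (expectation (\<lambda>\<omega>. exp (- t * X \<omega>)))" if "t > 0" for t
    using LT[of t] that by simp
  have "((\<lambda>t. - ln (expectation (\<lambda>\<omega>. exp (- t * X \<omega>)))) has_real_derivative D / exp (- \<phi> s)) (at s)"
    using DERIV_minus[OF DERIV_chain2[OF DERIV_ln_divide has_derivative_laplace_transform[OF X nonneg s]]] LT[of s] s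
    by (simp add: D_def)
  then have der: "(\<phi> has_real_derivative D / exp (- \<phi> s)) (at s)"
    by (rule has_field_derivative_transform_within_open[where S = "{0<..}"])
       (use s \<phi>_eq in auto)
  then have deq: "deriv \<phi> s = D / exp (- \<phi> s)" by (rule DERIV_imp_deriv)
  show "(\<phi> has_real_derivative deriv \<phi> s) (at s)" using der deq by simp
  have iX: "integrable M (\<lambda>\<omega>. X \<omega> * exp (- s * X \<omega>))"
    by (rule integrable_const_bound[where B = "1 / s"])
       (use s nonneg mult_exp_neg_le[of s] in \<open>auto simp: abs_mult\<close>)
  show "0 \<le> deriv \<phi> s"
    unfolding deq D_def by (intro divide_nonneg_pos integral_nonneg_AE) (use nonneg in auto)
  have "s * D = expectation (\<lambda>\<omega>. s * (X \<omega> * exp (- s * X \<omega>)))" by (simp add: D_def)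
  also have "\<dots> \<le> expectation (\<lambda>\<omega>. \<phi> s * exp (- s * X \<omega>) + (exp (- \<phi> s) - exp (- s * X \<omega>)))"
  proof (rule integral_mono)
    fix \<omega> assume "\<omega> \<in> space M"
    \<comment> \<open>with \<open>y = exp (- s * X \<omega>)\<close> and \<open>p = exp (- \<phi> s)\<close>, this is \<open>y * ln (p / y) \<le> p - y\<close>\<close>
    have "exp (- s * X \<omega>) * (1 + (s * X \<omega> - \<phi> s)) \<le> exp (- s * X \<omega>) * exp (s * X \<omega> - \<phi> s)"
      by (intro mult_left_mono exp_ge_add_one_self) auto
    then show "s * (X \<omega> * exp (- s * X \<omega>)) \<le> \<phi> s * exp (- s * X \<omega>) + (exp (- \<phi> s) - exp (- s * X \<omega>))"
      by (simp add: algebra_simps flip: exp_add)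
  qed (use iX int s in auto)
  also have "\<dots> = \<phi> s * exp (- \<phi> s)"
    using int[of s] LT[of s] s by (simp add: prob_space)
  finally show "s * deriv \<phi> s \<le> \<phi> s"
    unfolding deq by (simp add: divide_le_eq)
  show "0 < \<phi> s"
  \<comment> \<open>If \<open>\<phi> s \<le> 0\<close>, the nonnegative variable
    \<open>1 - exp (- s * X)\<close> has expectation at most 0. Then \<open>X\<close> vanishes
    almost everywhere, and so does \<phi> at \<open>q\<close>.\<close>
  proof (rule ccontr)
    assume "\<not> 0 < \<phi> s"
    then have "expectation (\<lambda>\<omega>. 1 - exp (- s * X \<omega>)) \<le> 0"
      using int[of s] LT[of s] s by (simp add: prob_space)
    moreover have nn: "AE \<omega> in M. 0 \<le> 1 - exp (- s * X \<omega>)" using nonneg s by auto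
    ultimately have "expectation (\<lambda>\<omega>. 1 - exp (- s * X \<omega>)) = 0"
      by (intro antisym integral_nonneg_AE)
    then have "AE \<omega> in M. 1 - exp (- s * X \<omega>) = 0"
      using integral_nonneg_eq_0_iff_AE[OF _ nn] int[of s] s by simp
    then have "AE \<omega> in M. exp (- q * X \<omega>) = 1"
      by eventually_elim (use s in auto)
    then have "expectation (\<lambda>\<omega>. exp (- q * X \<omega>)) = expectation (\<lambda>\<omega>. 1)"
      by (intro integral_cong_AE) auto
    then show False using LT[OF nz(1)] nz(2) by (simp add: prob_space)
  qed
qed

lemma nn_integral_indep_mult:
  assumes ind: "indep_var S X T Y"
    and [measurable]: "f \<in> borel_measurable S" "g \<in> borel_measurable T"
  shows "(\<integral>\<^sup>+\<omega>. f (X \<omega>) * g (Y \<omega>) \<partial>M) = (\<integral>\<^sup>+\<omega>. f (X \<omega>) \<partial>M) * (\<integral>\<^sup>+\<omega>. g (Y \<omega>) \<partial>M)"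
proof -
  have [measurable]: "X \<in> measurable M S" "Y \<in> measurable M T"
    and eq: "distr M (S \<Otimes>\<^sub>M T) (\<lambda>x. (X x, Y x)) = distr M S X \<Otimes>\<^sub>M distr M T Y"
    using ind by (auto simp: indep_var_distribution_eq)
  interpret X: prob_space "distr M S X" by (rule prob_space_distr) measurable
  interpret Y: prob_space "distr M T Y" by (rule prob_space_distr) measurable
  have "(\<integral>\<^sup>+\<omega>. f (X \<omega>) * g (Y \<omega>) \<partial>M) = (\<integral>\<^sup>+z. f (fst z) * g (snd z) \<partial>distr M (S \<Otimes>\<^sub>M T) (\<lambda>x. (X x, Y x)))"
    by (subst nn_integral_distr) auto
  also have "\<dots> = (\<integral>\<^sup>+x. \<integral>\<^sup>+y. f x * g y \<partial>distr M T Y \<partial>distr M S X)"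
    unfolding eq by (subst Y.nn_integral_fst[symmetric]) auto
  also have "\<dots> = (\<integral>\<^sup>+x. f x \<partial>distr M S X) * (\<integral>\<^sup>+y. g y \<partial>distr M T Y)"
    by (simp add: nn_integral_cmult nn_integral_multc)
  also have "\<dots> = (\<integral>\<^sup>+\<omega>. f (X \<omega>) \<partial>M) * (\<integral>\<^sup>+\<omega>. g (Y \<omega>) \<partial>M)"
    by (simp add: nn_integral_distr)
  finally show ?thesis .
qed

text \<open>Log-convexity is Hoelder's inequality, obtained from Young's inequality with weights
  \<open>1 - t\<close> and \<open>t\<close>. Positivity almost everywhere keeps the moments nonzero,
  since \<open>0 powr x\<close> is 0 for every exponent.\<close>

lemma log_convex_moments:
  fixes Y :: "'a \<Rightarrow> real"
  assumes [measurable]: "Y \<in> borel_measurable M" and pos: "AE \<omega> in M. 0 < Y \<omega>"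
    and int: "\<And>r. 0 < r \<Longrightarrow> integrable M (\<lambda>\<omega>. Y \<omega> powr (r - 1))"
  shows moment_pos: "0 < r \<Longrightarrow> 0 < expectation (\<lambda>\<omega>. Y \<omega> powr (r - 1))"
    and convex_on_ln_moment: "convex_on {0<..} (\<lambda>r. ln (expectation (\<lambda>\<omega>. Y \<omega> powr (r - 1))))"
proof -
  let ?f = "\<lambda>r. expectation (\<lambda>\<omega>. Y \<omega> powr (r - 1))"
  show f_pos: "0 < ?f r" if "0 < r" for r
  proof (rule ccontr)
    assume "\<not> 0 < ?f r"
    then have "?f r = 0" by (intro antisym integral_nonneg_AE) auto
    then have "AE \<omega> in M. Y \<omega> powr (r - 1) = 0"
      using int[OF that] by (subst (asm) integral_nonneg_eq_0_iff_AE) auto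
    with pos have "AE \<omega> in M. False" by eventually_elim auto
    then show False by simp
  qed
  show "convex_on {0<..} (\<lambda>r. ln (?f r))"
  proof (rule convex_onI)
    fix t p q :: real
    assume t: "0 < t" "t < 1" and pq: "p \<in> {0<..}" "q \<in> {0<..}"
    let ?r = "(1 - t) * p + t * q"
    have r: "?r > 0" using t pq by (simp add: add_pos_pos)
    \<comment> \<open>The Hoelder bound. Each power is divided by its own mean, so the two
      normalised terms have expectation 1 and the majorant has expectation exactly
      \<open>C\<close>.\<close>
    define C where "C = ?f p powr (1 - t) * ?f q powr t"
    have C: "C > 0" using f_pos[of p] f_pos[of q] pq by (simp add: C_def)
    have "?f ?r \<le> expectation (\<lambda>\<omega>. C * ((1 - t) * (Y \<omega> powr (p - 1) / ?f p) + t * (Y \<omega> powr (q - 1) / ?f q)))"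
    proof (rule integral_mono_AE)
      show "AE \<omega> in M. Y \<omega> powr (?r - 1) \<le> C * ((1 - t) * (Y \<omega> powr (p - 1) / ?f p) + t * (Y \<omega> powr (q - 1) / ?f q))"
        using pos
      proof eventually_elim
        fix \<omega> assume y: "0 < Y \<omega>"
        have "Y \<omega> powr (?r - 1) = (Y \<omega> powr (p - 1)) powr (1 - t) * (Y \<omega> powr (q - 1)) powr t"
          unfolding powr_powr powr_add[symmetric] by (simp add: algebra_simps)
        also have "\<dots> = C * ((Y \<omega> powr (p - 1) / ?f p) powr (1 - t) * (Y \<omega> powr (q - 1) / ?f q) powr t)"
          using f_pos[of p] f_pos[of q] pq by (simp add: C_def powr_divide)
        also have "\<dots> \<le> C * ((1 - t) * (Y \<omega> powr (p - 1) / ?f p) + t * (Y \<omega> powr (q - 1) / ?f q))"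
          using f_pos[of p] f_pos[of q] pq t C y by (intro mult_left_mono Youngs_inequality_0) auto
        finally show "Y \<omega> powr (?r - 1) \<le> C * ((1 - t) * (Y \<omega> powr (p - 1) / ?f p) + t * (Y \<omega> powr (q - 1) / ?f q))" .
      qed
    qed (use int[OF r] int[of p] int[of q] pq in auto)
    also have "\<dots> = C"
      using int[of p] int[of q] pq f_pos[of p] f_pos[of q] by simp
    finally have "ln (?f ?r) \<le> ln C" using C f_pos[OF r] by simp
    also have "\<dots> = (1 - t) * ln (?f p) + t * ln (?f q)"
      using f_pos[of p] f_pos[of q] pq by (simp add: C_def ln_mult ln_powr)
    finally show "ln (?f ((1 - t) *\<^sub>R p + t *\<^sub>R q)) \<le> (1 - t) * ln (?f p) + t * ln (?f q)" by simp
  qed (simp add: convex_real_interval)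
qed

end

subsection \<open>The measure with Laplace transform \<open>\<Phi>' / \<Phi>\<close>\<close>

text \<open>The numerator is the convex function \<open>exp (- (r - 1) * x)\<close> of
  \<open>r\<close> minus its chord through \<open>r = 1\<close> and \<open>r = 2\<close>, hence the
  zeros at these two points.\<close>

definition ratio_kernel :: "real \<Rightarrow> real \<Rightarrow> real" where
  "ratio_kernel r x = (exp (- (r - 1) * x) - 1 - (r - 1) * (exp (- x) - 1)) / (x * (exp x - 1))"

lemma ratio_kernel_1 [simp]: "ratio_kernel 1 x = 0"
  and ratio_kernel_2 [simp]: "ratio_kernel 2 x = 0"
  by (simp_all add: ratio_kernel_def)

text \<open>Here the factor \<open>exp x - 1\<close> of the denominator pays off: it divides the
  increment of the numerator and leaves a Frullani integrand.\<close>

lemma ratio_kernel_plus1: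
  assumes "x > 0"
  shows "ratio_kernel (r + 1) x = ratio_kernel r x + (exp (- x) - exp (- r * x)) / x"
proof -
  have ne: "exp x - 1 \<noteq> 0" using assms by simp
  have "exp (- (r + 1 - 1) * x) - 1 - (r + 1 - 1) * (exp (- x) - 1)
      = (exp (- (r - 1) * x) - 1 - (r - 1) * (exp (- x) - 1)) + (exp (- x) - exp (- r * x)) * (exp x - 1)"
    by (simp add: algebra_simps flip: exp_add)
  then show ?thesis
    unfolding ratio_kernel_def using ne by (simp only: add_divide_distrib mult_divide_mult_cancel_right simp_thms)
qed

text \<open>For fixed \<open>x\<close> the kernel is an exponential in \<open>r\<close> plus an
  affine function, over a positive constant. Convexity passes to the \<kappa>-integral and also
  replaces pointwise estimates.\<close>

lemma ratio_kernel_convex: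
  assumes "x > 0"
  shows "convex_on UNIV (\<lambda>r. ratio_kernel r x)"
proof -
  have "convex_on UNIV (\<lambda>r. (exp x * exp (- x * r) + (- 1 - (r - 1) * (exp (- x) - 1))) / (x * (exp x - 1)))"
  proof (intro convex_on_cdiv convex_on_add convex_on_cmul)
    show "convex_on UNIV (\<lambda>r. exp (- x * r))"
      by (rule f''_ge0_imp_convex[where f' = "\<lambda>r. - x * exp (- x * r)" and f'' = "\<lambda>r. x * x * exp (- x * r)"])
         (auto intro!: derivative_eq_intros simp: convex_UNIV)
    show "convex_on UNIV (\<lambda>r. - 1 - (r - 1) * (exp (- x) - 1))"
      by (rule f''_ge0_imp_convex[where f' = "\<lambda>r. - (exp (- x) - 1)" and f'' = "\<lambda>r. 0"])
         (auto intro!: derivative_eq_intros)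
  qed (use assms in auto)
  also have "(\<lambda>r. (exp x * exp (- x * r) + (- 1 - (r - 1) * (exp (- x) - 1))) / (x * (exp x - 1)))
      = (\<lambda>r. ratio_kernel r x)"
    by (simp add: ratio_kernel_def fun_eq_iff algebra_simps flip: exp_add)
  finally show ?thesis .
qed

lemma ratio_kernel_nonneg:
  assumes "x > 0" "r \<ge> 2"
  shows "0 \<le> ratio_kernel r x"
proof (cases "r = 2")
  case False
  \<comment> \<open>The weight that places 2 between 1 and \<open>r\<close>; as the kernel vanishes
    at 1 and 2, convexity leaves \<open>0 \<le> t * ratio_kernel r x\<close>.\<close>
  define t where "t = 1 / (r - 1)"
  have t: "0 < t" "t \<le> 1" and "t * (r - 1) = 1"
    using assms False by (auto simp: t_def)
  then have r2: "2 = (1 - t) * 1 + t * r" by (simp add: algebra_simps)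
  have "ratio_kernel ((1 - t) * 1 + t * r) x \<le> (1 - t) * ratio_kernel 1 x + t * ratio_kernel r x"
    using convex_onD[OF ratio_kernel_convex[OF assms(1)], of t 1 r] t by simp
  then have "ratio_kernel 2 x \<le> (1 - t) * ratio_kernel 1 x + t * ratio_kernel r x"
    by (simp only: r2[symmetric])
  then show ?thesis using t(1) by (simp add: zero_le_mult_iff)
qed simp

lemma ratio_kernel_mono:
  assumes "x > 0" "2 \<le> r" "r \<le> q"
  shows "ratio_kernel r x \<le> ratio_kernel q x"
proof (cases "q = 2")
  case False
  define t where "t = (r - 2) / (q - 2)"
  have t: "0 \<le> t" "t \<le> 1" and "t * (q - 2) = r - 2"
    using assms False by (auto simp: t_def)
  then have rq: "r = (1 - t) * 2 + t * q" by (simp add: algebra_simps)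
  have "ratio_kernel ((1 - t) * 2 + t * q) x \<le> (1 - t) * ratio_kernel 2 x + t * ratio_kernel q x"
    using convex_onD[OF ratio_kernel_convex[OF assms(1)], of t 2 q] t by simp
  then have "ratio_kernel r x \<le> (1 - t) * ratio_kernel 2 x + t * ratio_kernel q x"
    by (simp only: rq[symmetric])
  also have "\<dots> \<le> ratio_kernel q x"
    using t(2) ratio_kernel_nonneg[of x q] assms by (simp add: mult_left_le_one_le t(1))
  finally show ?thesis .
qed (use assms in auto)

lemma ratio_kernel_measurable [measurable]: "ratio_kernel r \<in> borel_measurable borel"
  unfolding ratio_kernel_def[abs_def] by measurable

section \<open>Integration against a measure with Laplace transform \<Phi>' / \<Phi>\<close>

locale log_derivative_measure =
  fixes \<kappa> :: "real measure" and \<Phi> \<Phi>' :: "real \<Rightarrow> real"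
  assumes sets_kappa [measurable_cong, simp]: "sets \<kappa> = sets borel"
    and kappa_neg: "emeasure \<kappa> {..<0} = 0"
    and Phi_pos: "\<And>s. s > 0 \<Longrightarrow> \<Phi> s > 0"
    and Phi_deriv: "\<And>s. s > 0 \<Longrightarrow> (\<Phi> has_real_derivative \<Phi>' s) (at s)"
    and Phi'_nonneg: "\<And>s. s > 0 \<Longrightarrow> \<Phi>' s \<ge> 0"
    and Phi'_le: "\<And>s. s > 0 \<Longrightarrow> s * \<Phi>' s \<le> \<Phi> s"
    and LT: "\<And>s. s > 0 \<Longrightarrow> (\<integral>\<^sup>+x. ennreal (exp (- s * x)) \<partial>\<kappa>) = ennreal (\<Phi>' s / \<Phi> s)"
begin

lemma space_kappa [simp]: "space \<kappa> = UNIV"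
  using sets_eq_imp_space_eq[OF sets_kappa] by simp

text \<open>An atom at 0 would bound the Laplace transform from below by its mass at every
  \<open>s\<close>, but the transform is at most \<open>1 / s\<close>.\<close>

lemma kappa_0: "emeasure \<kappa> {0} = 0"
proof (rule antisym)
  have le: "emeasure \<kappa> {0} \<le> ennreal (inverse (real (Suc n)))" for n
  proof -
    have "emeasure \<kappa> {0} = (\<integral>\<^sup>+x. indicator {0} x \<partial>\<kappa>)" by simp
    also have "\<dots> \<le> (\<integral>\<^sup>+x. ennreal (exp (- real (Suc n) * x)) \<partial>\<kappa>)"
      by (intro nn_integral_mono) (auto simp: indicator_def)
    also have "\<dots> = ennreal (\<Phi>' (real (Suc n)) / \<Phi> (real (Suc n)))" by (rule LT) simp
    also have "\<dots> \<le> ennreal (inverse (real (Suc n)))"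
      using Phi'_le[of "real (Suc n)"] Phi_pos[of "real (Suc n)"]
      by (intro ennreal_leI) (simp add: field_simps del: of_nat_Suc)
    finally show ?thesis .
  qed
  have "(\<lambda>n. ennreal (inverse (real (Suc n)))) \<longlonglongrightarrow> ennreal 0"
    by (intro tendsto_ennrealI LIMSEQ_inverse_real_of_nat)
  then show "emeasure \<kappa> {0} \<le> 0"
    using le by (intro LIMSEQ_le_const[where X = "\<lambda>n. ennreal (inverse (real (Suc n)))"]) auto
qed simp

lemma AE_kappa_pos: "AE x in \<kappa>. x > 0"
proof -
  have "{..<0} \<in> null_sets \<kappa>" "{0} \<in> null_sets \<kappa>"
    using kappa_neg kappa_0 by (simp_all add: null_sets_def)
  then have "AE x in \<kappa>. x \<notin> {..<0}" "AE x in \<kappa>. x \<notin> {0}"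
    by (auto dest: AE_not_in)
  then show ?thesis by eventually_elim auto
qed

text \<open>On \<open>{0..n}\<close> the weight \<open>exp (- x)\<close> is at least
  \<open>exp (- n)\<close>, and the transform at 1 is finite. The exchange of integrals in
  Frullani's formula rests on this.\<close>

sublocale sigma_finite_measure \<kappa>
proof
  have fin: "emeasure \<kappa> {0..real n} \<noteq> \<infinity>" for n
  proof -
    have "emeasure \<kappa> {0..real n} = (\<integral>\<^sup>+x. indicator {0..real n} x \<partial>\<kappa>)" by simp
    also have "\<dots> \<le> (\<integral>\<^sup>+x. ennreal (exp (real n)) * ennreal (exp (- 1 * x)) \<partial>\<kappa>)"
      by (intro nn_integral_mono)
         (auto simp: indicator_def ennreal_mult[symmetric] simp flip: exp_add)
    also have "\<dots> = ennreal (exp (real n)) * ennreal (\<Phi>' 1 / \<Phi> 1)"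
      by (subst nn_integral_cmult) (simp_all only: LT[OF zero_less_one], measurable)
    also have "\<dots> < \<infinity>" by (simp add: ennreal_mult_less_top)
    finally show ?thesis by simp
  qed
  have cover: "\<exists>n. x \<le> real n" for x using real_arch_simple by blast
  show "\<exists>A. countable A \<and> A \<subseteq> sets \<kappa> \<and> \<Union> A = space \<kappa> \<and> (\<forall>a\<in>A. emeasure \<kappa> a \<noteq> \<infinity>)"
    by (rule exI[of _ "insert {..<0} (range (\<lambda>n. {0..real n}))"])
       (use fin kappa_neg cover in \<open>auto simp: not_le\<close>)
qed

text \<open>The integrand is the integral of \<open>exp (- s * x)\<close> over \<open>s\<close> in
  \<open>{a..b}\<close>. Exchanging integrals leaves the integral of the logarithmic derivative of
  \<Phi> over \<open>{a..b}\<close>.\<close>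

lemma frullani:
  assumes a: "0 < a" "a \<le> b"
  shows "(\<integral>\<^sup>+x. ennreal (indicator {0<..} x * ((exp (- a * x) - exp (- b * x)) / x)) \<partial>\<kappa>)
    = ennreal (ln (\<Phi> b) - ln (\<Phi> a))"
proof -
  interpret pair_sigma_finite lborel \<kappa> ..
  have inner: "(\<integral>\<^sup>+s. ennreal (exp (- s * x)) * indicator {a..b} s \<partial>lborel)
      = ennreal ((exp (- a * x) - exp (- b * x)) / x)" if "x > 0" for x
    by (subst nn_integral_FTC_Icc[where F = "\<lambda>s. - exp (- s * x) / x"])
       (use that a in \<open>auto intro!: derivative_eq_intros arg_cong[where f = ennreal] simp: field_simps\<close>)
  have "(\<integral>\<^sup>+x. ennreal (indicator {0<..} x * ((exp (- a * x) - exp (- b * x)) / x)) \<partial>\<kappa>)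
      = (\<integral>\<^sup>+x. (\<integral>\<^sup>+s. ennreal (exp (- s * x)) * indicator {a..b} s \<partial>lborel) \<partial>\<kappa>)"
    by (rule nn_integral_cong_AE) (use AE_kappa_pos inner in \<open>auto elim!: eventually_mono\<close>)
  also have "\<dots> = (\<integral>\<^sup>+s. (\<integral>\<^sup>+x. ennreal (exp (- s * x)) * indicator {a..b} s \<partial>\<kappa>) \<partial>lborel)"
    by (rule Fubini') measurable
  \<comment> \<open>The fundamental theorem wants a measurable real integrand on the whole line. The
    transform itself is measurable there, whereas \<open>\<Phi>' s / \<Phi> s\<close> is only
    controlled for positive \<open>s\<close>.\<close>
  also have "\<dots> = (\<integral>\<^sup>+s. ennreal (enn2real (\<integral>\<^sup>+x. ennreal (exp (- s * x)) \<partial>\<kappa>)) * indicator {a..b} s \<partial>lborel)"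
  proof (intro nn_integral_cong)
    fix s
    show "(\<integral>\<^sup>+x. ennreal (exp (- s * x)) * indicator {a..b} s \<partial>\<kappa>)
      = ennreal (enn2real (\<integral>\<^sup>+x. ennreal (exp (- s * x)) \<partial>\<kappa>)) * indicator {a..b} s"
    proof (cases "s \<in> {a..b}")
      case True
      with a have "s > 0" by simp
      then have "(\<integral>\<^sup>+x. ennreal (exp (- s * x)) \<partial>\<kappa>) \<noteq> \<top>" by (simp only: LT) simp
      then show ?thesis using True by (simp add: less_top)
    qed simp
  qed
  also have "\<dots> = ennreal (ln (\<Phi> b) - ln (\<Phi> a))"
  proof (rule nn_integral_FTC_Icc[where F = "\<lambda>s. ln (\<Phi> s)"])
    show "(\<lambda>s. enn2real (\<integral>\<^sup>+x. ennreal (exp (- s * x)) \<partial>\<kappa>)) \<in> borel_measurable borel"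
      by measurable
    fix s assume "s \<in> {a..b}"
    with a have s: "s > 0" by simp
    have LT': "enn2real (\<integral>\<^sup>+x. ennreal (exp (- s * x)) \<partial>\<kappa>) = \<Phi>' s / \<Phi> s"
      using s Phi'_nonneg[of s] Phi_pos[of s] by (simp only: LT) simp
    show "((\<lambda>s. ln (\<Phi> s)) has_real_derivative enn2real (\<integral>\<^sup>+x. ennreal (exp (- s * x)) \<partial>\<kappa>)) (at s)"
      unfolding LT' using DERIV_chain2[OF DERIV_ln_divide[OF Phi_pos[OF s]] Phi_deriv[OF s]] by simp
  qed (use a in auto)
  finally show ?thesis .
qed

text \<open>The integrand changes sign with \<open>r - 1\<close>, so the nonnegative formula is used
  on \<open>{1..r}\<close> or, with a minus sign, on \<open>{r..1}\<close>.\<close>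

lemma frullani_has_integral:
  assumes r: "0 < r"
  shows "has_bochner_integral \<kappa> (\<lambda>x. indicator {0<..} x *\<^sub>R ((exp (- x) - exp (- r * x)) / x)) (ln (\<Phi> r) - ln (\<Phi> 1))"
proof -
  have main: "has_bochner_integral \<kappa> (\<lambda>x. indicator {0<..} x * ((exp (- a * x) - exp (- b * x)) / x)) (ln (\<Phi> b) - ln (\<Phi> a))"
    if "0 < a" "a \<le> b" for a b
  proof (rule has_bochner_integral_nn_integral)
    show "AE x in \<kappa>. 0 \<le> indicator {0<..} x * ((exp (- a * x) - exp (- b * x)) / x)"
      using that by (auto simp: indicator_def)
    have "\<Phi> a \<le> \<Phi> b"
    proof (rule DERIV_nonneg_imp_nondecreasing[OF that(2)])
      fix x assume "a \<le> x" "x \<le> b"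
      with that have "x > 0" by linarith
      then show "\<exists>y. (\<Phi> has_real_derivative y) (at x) \<and> 0 \<le> y"
        using Phi_deriv Phi'_nonneg by blast
    qed
    then show "0 \<le> ln (\<Phi> b) - ln (\<Phi> a)" using Phi_pos[of a] that by simp
  qed (use frullani[OF that] in \<open>auto simp: borel_measurable_indicator\<close>)
  show ?thesis
  proof (cases "r \<ge> 1")
    case True
    then show ?thesis using main[of 1 r] by simp
  next
    case False
    then have "has_bochner_integral \<kappa> (\<lambda>x. - (indicator {0<..} x * ((exp (- r * x) - exp (- 1 * x)) / x))) (- (ln (\<Phi> 1) - ln (\<Phi> r)))"
      using main[of r 1] r by (intro has_bochner_integral_minus) simp
    moreover have "(\<lambda>x. - (indicator {0<..} x * ((exp (- r * x) - exp (- 1 * x)) / x)))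
      = (\<lambda>x. indicator {0<..} x *\<^sub>R ((exp (- x) - exp (- r * x)) / x))"
      by (auto simp: fun_eq_iff indicator_def diff_divide_distrib)
    ultimately show ?thesis by simp
  qed
qed

definition kernel_integral :: "real \<Rightarrow> real" where
  "kernel_integral r = (LINT x:{0<..}|\<kappa>. ratio_kernel r x)"

lemma ratio_kernel_plus1_indicator:
  "indicator {0<..} x *\<^sub>R ratio_kernel (r + 1) x
   = indicator {0<..} x *\<^sub>R ratio_kernel r x + indicator {0<..} x *\<^sub>R ((exp (- x) - exp (- r * x)) / x)"
  by (cases "x > 0") (simp_all add: ratio_kernel_plus1 del: minus_mult_commute)

lemma set_integrable_ratio_kernel_plus1:
  assumes "r > 0"
  shows "set_integrable \<kappa> {0<..} (ratio_kernel (r + 1)) \<longleftrightarrow> set_integrable \<kappa> {0<..} (ratio_kernel r)"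
proof -
  note i = integrable.intros[OF frullani_has_integral[OF assms]]
  show ?thesis
    unfolding set_integrable_def ratio_kernel_plus1_indicator
  proof
    assume "integrable \<kappa> (\<lambda>x. indicator {0<..} x *\<^sub>R ratio_kernel r x
        + indicator {0<..} x *\<^sub>R ((exp (- x) - exp (- r * x)) / x))"
    from Bochner_Integration.integrable_diff[OF this i]
    show "integrable \<kappa> (\<lambda>x. indicator {0<..} x *\<^sub>R ratio_kernel r x)" by simp
  qed (rule Bochner_Integration.integrable_add[OF _ i])
qed

text \<open>No pointwise estimate is needed: the kernel is convex in \<open>r\<close> and vanishes at \<open>r = 1\<close> and \<open>r = 2\<close>,
  hence is monotone in \<open>r\<close> beyond \<open>2\<close>, and shifting \<open>r\<close> by one only adds a Frullani integrand.\<close>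

lemma set_integrable_ratio_kernel:
  assumes "r > 0"
  shows "set_integrable \<kappa> {0<..} (ratio_kernel r)"
proof -
  have nat: "set_integrable \<kappa> {0<..} (ratio_kernel (real (Suc n)))" for n
  proof (induction n)
    case 0
    show ?case by (simp add: set_integrable_def)
  next
    case (Suc n)
    then show ?case using set_integrable_ratio_kernel_plus1[of "real (Suc n)"] by (simp add: add.commute)
  qed
  have ge2: "set_integrable \<kappa> {0<..} (ratio_kernel r)" if "r \<ge> 2" for r
  proof -
    obtain n where "r \<le> real n" using real_arch_simple by blast
    then have n: "r \<le> real (Suc n)" by simp
    show ?thesis
      unfolding set_integrable_def
    proof (rule Bochner_Integration.integrable_bound[OF nat[of n, unfolded set_integrable_def]])
      show "AE x in \<kappa>. norm (indicator {0<..} x *\<^sub>R ratio_kernel r x) \<le> norm (indicator {0<..} x *\<^sub>R ratio_kernel (real (Suc n)) x)"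
      proof (rule AE_I2)
        fix x :: real
        show "norm (indicator {0<..} x *\<^sub>R ratio_kernel r x) \<le> norm (indicator {0<..} x *\<^sub>R ratio_kernel (real (Suc n)) x)"
          using ratio_kernel_mono[of x r "real (Suc n)"] ratio_kernel_nonneg[of x r] that n
          by (cases "x > 0") (auto simp del: of_nat_Suc)
      qed
    qed measurable
  qed
  \<comment> \<open>Two shifts move any positive \<open>r\<close> into the range where domination
    works; the equivalence then brings integrability back down.\<close>
  have "set_integrable \<kappa> {0<..} (ratio_kernel (r + 1 + 1))" using ge2[of "r + 1 + 1"] assms by simp
  then show ?thesis
    using set_integrable_ratio_kernel_plus1[of r] set_integrable_ratio_kernel_plus1[of "r + 1"] assms by simp
qed

lemma kernel_integral_1: "kernel_integral 1 = 0"
  by (simp add: kernel_integral_def)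

lemma kernel_integral_plus1:
  assumes "r > 0"
  shows "kernel_integral (r + 1) = kernel_integral r + (ln (\<Phi> r) - ln (\<Phi> 1))"
proof -
  note i = frullani_has_integral[OF assms]
  have "kernel_integral (r + 1) = kernel_integral r + (LINT x|\<kappa>. indicator {0<..} x *\<^sub>R ((exp (- x) - exp (- r * x)) / x))"
    unfolding kernel_integral_def set_lebesgue_integral_def ratio_kernel_plus1_indicator
    using set_integrable_ratio_kernel[OF assms] integrable.intros[OF i]
    by (intro Bochner_Integration.integral_add) (auto simp: set_integrable_def)
  then show ?thesis by (simp only: has_bochner_integral_integral_eq[OF i])
qed

lemma kernel_integral_convex: "convex_on {0<..} kernel_integral"
proof (rule convex_onI)
  fix t p q :: real
  assume t: "0 < t" "t < 1" and pq: "p \<in> {0<..}" "q \<in> {0<..}"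
  let ?r = "(1 - t) * p + t * q"
  have r: "?r > 0" using t pq by (simp add: add_pos_pos)
  have i: "set_integrable \<kappa> {0<..} (\<lambda>x. (1 - t) * ratio_kernel p x)" "set_integrable \<kappa> {0<..} (\<lambda>x. t * ratio_kernel q x)"
    using pq by (simp_all add: set_integrable_ratio_kernel)
  have "kernel_integral ?r \<le> (LINT x:{0<..}|\<kappa>. (1 - t) * ratio_kernel p x + t * ratio_kernel q x)"
    unfolding kernel_integral_def
  proof (rule set_integral_mono)
    fix x :: real assume "x \<in> {0<..}"
    then show "ratio_kernel ?r x \<le> (1 - t) * ratio_kernel p x + t * ratio_kernel q x"
      using convex_onD[OF ratio_kernel_convex, of x t p q] t by simp
  qed (use i r in \<open>auto intro!: set_integrable_ratio_kernel\<close>)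
  also have "\<dots> = (1 - t) * kernel_integral p + t * kernel_integral q"
    using i by (simp add: set_integral_add kernel_integral_def)
  finally show "kernel_integral ((1 - t) *\<^sub>R p + t *\<^sub>R q) \<le> (1 - t) * kernel_integral p + t * kernel_integral q" by simp
qed (simp add: convex_real_interval)

end

subsection \<open>Integrals of decreasing functions\<close>

text \<open>The tail integral \<open>G\<close> pushes the measure with density \<open>g\<close> forward to Lebesgue measure on
  \<open>{0<..<G 0}\<close>, so that \<open>G\<close> need not be differentiated at the jumps of \<open>g\<close>.\<close>

lemma nn_integral_tail_powr:
  fixes g G :: "real \<Rightarrow> real"
  assumes [measurable]: "g \<in> borel_measurable borel"
    and pos: "\<And>s. 0 \<le> s \<Longrightarrow> 0 < g s"
    and dec: "\<And>s t. 0 \<le> s \<Longrightarrow> s \<le> t \<Longrightarrow> g t \<le> g s"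
    and fin: "(\<integral>\<^sup>+l. ennreal (g l) * indicator {0..} l \<partial>lborel) < \<infinity>"
    and G: "\<And>s. 0 \<le> s \<Longrightarrow> G s = enn2real (\<integral>\<^sup>+l. ennreal (g l) * indicator {s..} l \<partial>lborel)"
    and p: "p > 0"
  shows "(\<integral>\<^sup>+s. ennreal (g s * G s powr (p - 1)) * indicator {0..} s \<partial>lborel) = ennreal (G 0 powr p / p)"
proof -
  define \<nu> where "\<nu> = density lborel (\<lambda>l. ennreal (g l) * indicator {0..} l)"
  have [measurable_cong, simp]: "sets \<nu> = sets borel" and [simp]: "space \<nu> = UNIV" by (auto simp: \<nu>_def)
  have em: "emeasure \<nu> S = (\<integral>\<^sup>+l. ennreal (g l) * indicator {0..} l * indicator S l \<partial>lborel)"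
    if "S \<in> sets borel" for S
    using that by (simp add: \<nu>_def emeasure_density)
  interpret finite_measure \<nu>
    using fin by (intro finite_measureI) (simp add: em)
  \<comment> \<open>The tail is taken on the whole line, where it is constant left of 0, so that
    \<open>H\<close> is continuous and measurable without restricting its domain.\<close>
  define H where "H s = measure \<nu> {s..}" for s
  have H0: "H s = measure \<nu> UNIV" if "s \<le> 0" for s
  proof -
    have "emeasure \<nu> {s..} = emeasure \<nu> UNIV"
      using that by (auto simp: em indicator_def intro!: nn_integral_cong)
    then show ?thesis by (simp add: H_def measure_def)
  qed
  have GH: "G s = H s" if "s \<ge> 0" for s
    unfolding H_def measure_def G[OF that]
    by (rule arg_cong[where f = enn2real])
       (use that in \<open>auto simp: em indicator_def intro!: nn_integral_cong\<close>)
  have diff: "H s - H t = measure \<nu> {s..<t}" if "s \<le> t" for s t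
  proof -
    have "{s..} = {s..<t} \<union> {t..}" using that by auto
    then have "H s = measure \<nu> {s..<t} + H t"
      unfolding H_def by (subst finite_measure_Union[symmetric]) auto
    then show ?thesis by simp
  qed
  have diff_le: "H s - H t \<le> g 0 * (t - s)" if "s \<le> t" for s t
  proof -
    have "emeasure \<nu> {s..<t} \<le> (\<integral>\<^sup>+l. ennreal (g 0) * indicator {s..<t} l \<partial>lborel)"
      unfolding em[of "{s..<t}", simplified]
      by (intro nn_integral_mono) (auto simp: indicator_def intro!: ennreal_leI dec)
    also have "\<dots> = ennreal (g 0 * (t - s))"
      using that pos[of 0] by (simp add: nn_integral_cmult_indicator ennreal_mult)
    finally show ?thesis
      using that pos[of 0] unfolding diff[OF that] by (simp add: emeasure_eq_measure)
  qed
  have diff_ge: "g t * (t - s) \<le> H s - H t" if "0 \<le> s" "s \<le> t" for s t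
  proof -
    have "(\<integral>\<^sup>+l. ennreal (g t) * indicator {s..<t} l \<partial>lborel) \<le> emeasure \<nu> {s..<t}"
      unfolding em[of "{s..<t}", simplified] using that
      by (intro nn_integral_mono) (auto simp: indicator_def intro!: ennreal_leI dec)
    moreover have "(\<integral>\<^sup>+l. ennreal (g t) * indicator {s..<t} l \<partial>lborel) = ennreal (g t * (t - s))"
      using that pos[of t] by (simp add: nn_integral_cmult_indicator ennreal_mult)
    ultimately show ?thesis
      using that pos[of t] unfolding diff[OF that(2)] by (simp add: emeasure_eq_measure)
  qed
  have anti: "H t \<le> H s" if "s \<le> t" for s t
    using diff[OF that] measure_nonneg[of \<nu> "{s..<t}"] by linarith
  have strict: "H t < H s" if "0 \<le> s" "s < t" for s t
    using diff_ge[of s t] that pos[of t] mult_pos_pos[of "g t" "t - s"] by linarith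
  \<comment> \<open>The density is bounded by \<open>g 0\<close>, so the tail is Lipschitz with that
    constant even where \<open>g\<close> jumps.\<close>
  have cont: "continuous_on UNIV H"
  proof (rule lipschitz_on_continuous_on)
    show "(g 0)-lipschitz_on UNIV H"
    proof (rule lipschitz_onI)
      fix s t :: real
      show "dist (H s) (H t) \<le> g 0 * dist s t"
        using diff_le[of s t] diff_le[of t s] anti[of s t] anti[of t s]
        by (cases "s \<le> t") (auto simp: dist_real_def)
    qed (use pos[of 0] in auto)
  qed
  then have Hm[measurable]: "H \<in> borel_measurable borel" by (rule borel_measurable_continuous_onI)
  have lim: "(\<lambda>n. H (real n)) \<longlonglongrightarrow> 0"
  proof -
    have "(\<Inter>n. {real n..}) = {}"
      by (auto simp: set_eq_iff not_le intro: reals_Archimedean2)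

    then show ?thesis
      unfolding H_def using finite_Lim_measure_decseq[of "\<lambda>n. {real n..}"]
      by (auto simp: decseq_def image_subset_iff)
  qed
  have Hpos: "H s > 0" for s
    using strict[of "max s 0" "max s 0 + 1"] anti[of s "max s 0"] measure_nonneg[of \<nu> "{max s 0 + 1..}"]
    by (smt (verit, ccfv_threshold) H_def measure_nonneg)
  \<comment> \<open>Both measures are compared on rays. For \<open>0 < a < H 0\<close>, continuity
    and strict decrease give \<open>c\<close> with \<open>H c = a\<close>, so \<open>a < H s\<close>
    means \<open>s < c\<close>; the \<nu>-mass left of \<open>c\<close> is \<open>H 0 - a\<close>,
    the length of \<open>{a<..<H 0}\<close>.\<close>
  have push: "distr \<nu> borel H = density lborel (indicator {0<..<H 0})"
  proof (rule measure_eqI_lessThan)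
    fix a :: real
    show "emeasure (distr \<nu> borel H) {a<..} < \<infinity>"
      by (subst emeasure_distr) (auto simp: less_top[symmetric])
    have L: "emeasure (distr \<nu> borel H) {a<..} = emeasure \<nu> {s. a < H s}"
      by (auto simp: emeasure_distr vimage_def)
    have R: "emeasure (density lborel (indicator {0<..<H 0})) {a<..} =
       emeasure lborel ({0<..<H 0} \<inter> {a<..})"
      by (subst emeasure_density) (auto simp flip: indicator_inter_arith nn_integral_indicator simp: mult.commute Int_commute)
    consider "a \<le> 0" | "a \<ge> H 0" | "0 < a" "a < H 0" by linarith
    then have "emeasure \<nu> {s. a < H s} = emeasure lborel ({0<..<H 0} \<inter> {a<..})"
    proof cases
      case 1
      then have "{s. a < H s} = UNIV" "{0<..<H 0} \<inter> {a<..} = {0<..<H 0}"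
        using Hpos by (auto intro: le_less_trans)
      then show ?thesis using Hpos[of 0] by (simp add: H0 emeasure_eq_measure)
    next
      case 2
      then have "{s. a < H s} = {}" "{0<..<H 0} \<inter> {a<..} = {}"
        using anti[of 0] H0 by (smt (verit) Collect_empty_eq, auto)
      then show ?thesis by simp
    next
      case 3
      obtain n where n: "H (real n) < a"
        using order_tendstoD(2)[OF lim 3(1)] by (auto simp: eventually_sequentially)
      obtain c where c: "0 \<le> c" "H c = a"
        using IVT2'[of H "real n" a 0] n 3 cont continuous_on_subset by fastforce
      have "a < H s \<longleftrightarrow> s < c" for s
        using strict[of s c] anti[of s 0] anti[of c s] c 3
        by (cases "s < c"; cases "s < 0") auto
      then have "{s. a < H s} = {..<c}" by auto
      moreover have "emeasure \<nu> {..<c} = ennreal (H 0 - H c)"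
      proof -
        have "emeasure \<nu> {..<c} = emeasure \<nu> {0..<c}"
          by (auto simp: em indicator_def intro!: nn_integral_cong)
        then show ?thesis using diff[OF c(1)] by (simp add: emeasure_eq_measure)
      qed
      moreover have "{0<..<H 0} \<inter> {a<..} = {a<..<H 0}" using 3 by auto
      ultimately show ?thesis using 3 c by simp
    qed
    then show "emeasure (distr \<nu> borel H) {a<..} = emeasure (density lborel (indicator {0<..<H 0})) {a<..}"
      unfolding L R .
  qed auto
  have "(\<integral>\<^sup>+s. ennreal (g s * G s powr (p - 1)) * indicator {0..} s \<partial>lborel)
      = (\<integral>\<^sup>+s. (ennreal (g s) * indicator {0..} s) * ennreal (H s powr (p - 1)) \<partial>lborel)"
    by (intro nn_integral_cong) (auto simp: indicator_def GH ennreal_mult' pos less_imp_le)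
  also have "\<dots> = (\<integral>\<^sup>+s. ennreal (H s powr (p - 1)) \<partial>\<nu>)"
    unfolding \<nu>_def by (subst nn_integral_density) auto
  also have "\<dots> = (\<integral>\<^sup>+x. ennreal (x powr (p - 1)) \<partial>distr \<nu> borel H)"
    by (subst nn_integral_distr) auto
  also have "\<dots> = (\<integral>\<^sup>+x. indicator {0<..<H 0} x * ennreal (x powr (p - 1)) \<partial>lborel)"
    unfolding push by (subst nn_integral_density) auto
  also have "\<dots> = (\<integral>\<^sup>+x. ennreal (x powr (p - 1)) * indicator {0..H 0} x \<partial>lborel)"
  proof (rule nn_integral_cong_AE)
    have "AE x in lborel. x \<noteq> 0 \<and> x \<noteq> H 0"
      using AE_lborel_singleton[of 0] AE_lborel_singleton[of "H 0"] by eventually_elim auto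
    then show "AE x in lborel. indicator {0<..<H 0} x * ennreal (x powr (p - 1)) =
        ennreal (x powr (p - 1)) * indicator {0..H 0} x"
      by eventually_elim (auto simp: indicator_def)
  qed
  also have "\<dots> = ennreal (H 0 powr p / p)"
    using nn_integral_has_integral_lebesgue'[OF _ has_integral_powr_from_0[of "p - 1" "H 0"]] p Hpos[of 0]
    by simp
  finally show ?thesis by (simp add: GH)
qed

section \<open>Riemann sums of decreasing functions on the half-line\<close>

lemma riemann_sum_le_nn_integral:
  fixes h :: "real \<Rightarrow> real"
  assumes [measurable]: "h \<in> borel_measurable borel" and d: "0 < d"
    and dec: "\<And>u v. 0 \<le> u \<Longrightarrow> u \<le> v \<Longrightarrow> h v \<le> h u" and nonneg: "\<And>u. 0 \<le> u \<Longrightarrow> 0 \<le> h u"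
  shows "ennreal (\<Sum>k=1..N. d * h (real k * d)) \<le> (\<integral>\<^sup>+u. ennreal (h u) * indicator {0<..real N * d} u \<partial>lborel)"
proof (induction N)
  case (Suc N)
  let ?l = "real N * d" and ?r = "real (Suc N) * d"
  have lr: "0 \<le> ?l" "?l \<le> ?r" "?r - ?l = d" using d by (auto simp: algebra_simps)
  have split: "(\<integral>\<^sup>+u. ennreal (h u) * indicator {0<..l} u \<partial>lborel)
      + (\<integral>\<^sup>+u. ennreal (h u) * indicator {l<..r} u \<partial>lborel)
      = (\<integral>\<^sup>+u. ennreal (h u) * indicator {0<..r} u \<partial>lborel)" if "0 \<le> l" "l \<le> r" for l r
    using that by (subst nn_integral_add[symmetric]) (auto intro!: nn_integral_cong simp: indicator_def)
  have "ennreal (d * h ?r) = (\<integral>\<^sup>+u. ennreal (h ?r) * indicator {?l<..?r} u \<partial>lborel)"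
    using lr d nonneg[of ?r] by (subst nn_integral_cmult_indicator) (auto simp: ennreal_mult mult.commute)
  also have "\<dots> \<le> (\<integral>\<^sup>+u. ennreal (h u) * indicator {?l<..?r} u \<partial>lborel)"
  proof (rule nn_integral_mono)
    fix u
    have "h ?r \<le> h u" if "u \<in> {?l<..?r}"
      using that lr unfolding greaterThanAtMost_iff by (intro dec) linarith+
    then show "ennreal (h ?r) * indicator {?l<..?r} u \<le> ennreal (h u) * indicator {?l<..?r} u"
      by (auto simp: indicator_def simp del: of_nat_Suc intro: ennreal_leI)
  qed
  finally have step: "ennreal (d * h ?r) \<le> (\<integral>\<^sup>+u. ennreal (h u) * indicator {?l<..?r} u \<partial>lborel)" .
  have "ennreal (\<Sum>k=1..Suc N. d * h (real k * d)) = ennreal (\<Sum>k=1..N. d * h (real k * d)) + ennreal (d * h ?r)"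
    using d nonneg by (simp add: ennreal_plus sum_nonneg del: of_nat_Suc)
  also have "\<dots> \<le> (\<integral>\<^sup>+u. ennreal (h u) * indicator {0<..?l} u \<partial>lborel)
      + (\<integral>\<^sup>+u. ennreal (h u) * indicator {?l<..?r} u \<partial>lborel)"
    by (intro add_mono Suc.IH step)
  also have "\<dots> = (\<integral>\<^sup>+u. ennreal (h u) * indicator {0<..?r} u \<partial>lborel)"
    by (rule split[OF lr(1,2)])
  finally show ?case .
qed simp

text \<open>The sum that is a lower sum with right endpoints becomes an upper sum with left
  endpoints: term \<open>k\<close> now covers the cell after \<open>k * d\<close>, which is why the
  interval starts at \<open>d\<close>.\<close>

lemma nn_integral_le_riemann_sum:
  fixes h :: "real \<Rightarrow> real"
  assumes [measurable]: "h \<in> borel_measurable borel" and d: "0 < d"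
    and dec: "\<And>u v. 0 \<le> u \<Longrightarrow> u \<le> v \<Longrightarrow> h v \<le> h u" and nonneg: "\<And>u. 0 \<le> u \<Longrightarrow> 0 \<le> h u"
  shows "(\<integral>\<^sup>+u. ennreal (h u) * indicator {d<..real (Suc N) * d} u \<partial>lborel) \<le> ennreal (\<Sum>k=1..N. d * h (real k * d))"
proof (induction N)
  case (Suc N)
  let ?l = "real (Suc N) * d" and ?r = "real (Suc (Suc N)) * d"
  have lr: "d \<le> ?l" "0 \<le> ?l" "?l \<le> ?r" "?r - ?l = d" using d by (auto simp: algebra_simps)
  have "(\<integral>\<^sup>+u. ennreal (h u) * indicator {?l<..?r} u \<partial>lborel) \<le> (\<integral>\<^sup>+u. ennreal (h ?l) * indicator {?l<..?r} u \<partial>lborel)"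
    using lr by (intro nn_integral_mono) (auto simp: indicator_def simp del: of_nat_Suc intro!: ennreal_leI dec)
  also have "\<dots> = ennreal (d * h ?l)"
    using lr d nonneg[of ?l] by (subst nn_integral_cmult_indicator) (auto simp: ennreal_mult mult.commute simp del: of_nat_Suc)
  finally have step: "(\<integral>\<^sup>+u. ennreal (h u) * indicator {?l<..?r} u \<partial>lborel) \<le> ennreal (d * h ?l)" .
  have "(\<integral>\<^sup>+u. ennreal (h u) * indicator {d<..?r} u \<partial>lborel)
      = (\<integral>\<^sup>+u. ennreal (h u) * indicator {d<..?l} u \<partial>lborel) + (\<integral>\<^sup>+u. ennreal (h u) * indicator {?l<..?r} u \<partial>lborel)"
    using lr by (subst nn_integral_add[symmetric]) (auto intro!: nn_integral_cong simp: indicator_def simp del: of_nat_Suc)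
  also have "\<dots> \<le> ennreal (\<Sum>k=1..N. d * h (real k * d)) + ennreal (d * h ?l)"
    by (intro add_mono Suc.IH step)
  also have "\<dots> = ennreal (\<Sum>k=1..Suc N. d * h (real k * d))"
    using d nonneg by (simp add: ennreal_plus sum_nonneg del: of_nat_Suc)
  finally show ?case .
qed simp

text \<open>Mesh \<open>1 / Suc n\<close> with \<open>Suc n * Suc n\<close> points reaches
  \<open>Suc n\<close>, so the mesh shrinks while the horizon grows. Stating this through a
  threshold \<open>a\<close> also covers an infinite integral.\<close>

lemma eventually_less_riemann_sum:
  fixes h :: "real \<Rightarrow> real"
  assumes [measurable]: "h \<in> borel_measurable borel"
    and dec: "\<And>u v. 0 \<le> u \<Longrightarrow> u \<le> v \<Longrightarrow> h v \<le> h u" and nonneg: "\<And>u. 0 \<le> u \<Longrightarrow> 0 \<le> h u"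
    and a: "a < (\<integral>\<^sup>+u. ennreal (h u) * indicator {0..} u \<partial>lborel)"
  shows "\<forall>\<^sub>F n in sequentially. a < ennreal (\<Sum>k=1..Suc n * Suc n. 1 / real (Suc n) * h (real k * (1 / real (Suc n))))"
proof -
  \<comment> \<open>The grids are not nested, so monotone convergence is applied to these truncated
    integrals, which the Riemann sums dominate.\<close>
  let ?L = "\<lambda>n u. ennreal (h u) * indicator {1 / real (Suc n)<..real (Suc n)} u"
  have sup: "(SUP n. ?L n u) = ennreal (h u) * indicator {0<..} u" for u
  proof (cases "u > 0")
    case True
    obtain m where "u \<le> real m" using real_arch_simple by blast
    obtain k where "1 / real (Suc k) < u" using nat_approx_posE[OF True] by blast
    define n where "n = max m k"
    have "1 / real (Suc n) \<le> 1 / real (Suc k)" by (intro divide_left_mono) (auto simp: n_def)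
    then have "u \<in> {1 / real (Suc n)<..real (Suc n)}"
      using \<open>u \<le> real m\<close> \<open>1 / real (Suc k) < u\<close> by (auto simp: n_def)
    then have "?L n u = ennreal (h u)" by simp
    then show ?thesis using True
      by (intro antisym SUP_least) (auto simp: indicator_def intro!: SUP_upper2[of n])
  next
    case False
    have "?L n u = 0" for n
    proof -
      have "0 < 1 / real (Suc n)" by simp
      then have "u \<notin> {1 / real (Suc n)<..real (Suc n)}"
        using False unfolding greaterThanAtMost_iff by linarith
      then show ?thesis by simp
    qed
    then have "(\<lambda>n. ?L n u) = (\<lambda>n. 0)" by blast
    then show ?thesis using False by (simp only: SUP_const) simp
  qed
  have inc: "incseq ?L"
  proof (intro incseq_SucI le_funI)
    fix n u
    have "1 / real (Suc (Suc n)) \<le> 1 / real (Suc n)" by (intro divide_left_mono) auto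
    then show "?L n u \<le> ?L (Suc n) u" by (auto simp: indicator_def)
  qed
  have "(\<integral>\<^sup>+u. ennreal (h u) * indicator {0..} u \<partial>lborel) = (\<integral>\<^sup>+u. (SUP n. ?L n u) \<partial>lborel)"
    unfolding sup
    by (rule nn_integral_cong_AE)
       (use AE_lborel_singleton[of 0] in eventually_elim, auto simp: indicator_def)
  also have "\<dots> = (SUP n. integral\<^sup>N lborel (?L n))"
    by (rule nn_integral_monotone_convergence_SUP[OF inc]) measurable
  finally obtain n where n: "a < integral\<^sup>N lborel (?L n)" using a by (auto simp: less_SUP_iff)
  show ?thesis
    unfolding eventually_sequentially
  proof (intro exI[of _ n] allI impI)
    fix m assume "n \<le> m"
    let ?d = "1 / real (Suc m)"
    have "integral\<^sup>N lborel (?L n) \<le> integral\<^sup>N lborel (?L m)"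
      using inc \<open>n \<le> m\<close> by (intro nn_integral_mono) (auto simp: incseq_def le_fun_def)
    also have "\<dots> \<le> (\<integral>\<^sup>+u. ennreal (h u) * indicator {?d<..real (Suc (Suc m * Suc m)) * ?d} u \<partial>lborel)"
    proof (intro nn_integral_mono mult_left_mono)
      have "real (Suc m) \<le> real (Suc (Suc m * Suc m)) * ?d" by (simp add: field_simps)
      then show "indicator {?d<..real (Suc m)} u \<le> (indicator {?d<..real (Suc (Suc m * Suc m)) * ?d} u :: ennreal)" for u
        by (auto simp: indicator_def simp del: of_nat_Suc)
    qed auto
    also have "\<dots> \<le> ennreal (\<Sum>k=1..Suc m * Suc m. ?d * h (real k * ?d))"
      by (rule nn_integral_le_riemann_sum) (use dec nonneg in auto)
    finally show "a < ennreal (\<Sum>k=1..Suc m * Suc m. ?d * h (real k * ?d))"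
      using n by simp
  qed
qed

lemma nn_integral_exp_neg:
  fixes c :: real
  assumes "0 < c"
  shows "(\<integral>\<^sup>+l. ennreal (exp (- l * c)) * indicator {0..} l \<partial>lborel) = ennreal (1 / c)"
proof -
  have "((\<lambda>l. - exp (- l * c) / c) \<longlongrightarrow> 0) at_top"
    using assms by real_asymp
  then have "(\<integral>\<^sup>+l. ennreal (exp (- l * c)) * indicator {0..} l \<partial>lborel) = ennreal (0 - (- exp (- 0 * c) / c))"
    by (intro nn_integral_FTC_atLeast[where F = "\<lambda>l. - exp (- l * c) / c"])
       (use assms in \<open>auto intro!: derivative_eq_intros\<close>)
  then show ?thesis by simp
qed

subsection \<open>Independence of the shifted exponential functional\<close>

locale subordinator_process =
  fixes M :: "'a measure" and \<xi> :: "real \<Rightarrow> 'a \<Rightarrow> real"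
  assumes sub: "subordinator M \<xi>"
begin

sublocale prob_space M
  using sub by (simp add: subordinator_def)

lemma xi_measurable: "0 \<le> t \<Longrightarrow> \<xi> t \<in> borel_measurable M"
  and xi_0: "\<omega> \<in> space M \<Longrightarrow> \<xi> 0 \<omega> = 0"
  and xi_mono: "\<omega> \<in> space M \<Longrightarrow> 0 \<le> s \<Longrightarrow> s \<le> t \<Longrightarrow> \<xi> s \<omega> \<le> \<xi> t \<omega>"
  and xi_right_continuous: "\<omega> \<in> space M \<Longrightarrow> 0 \<le> t \<Longrightarrow> continuous (at_right t) (\<lambda>s. \<xi> s \<omega>)"
  and xi_indep: "0 \<le> ts 0 \<Longrightarrow> incseq ts \<Longrightarrow>
    indep_vars (\<lambda>_. borel) (\<lambda>i \<omega>. \<xi> (ts (Suc i)) \<omega> - \<xi> (ts i) \<omega>) {..<n}"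
  and xi_stationary: "0 \<le> s \<Longrightarrow> 0 \<le> t \<Longrightarrow>
    distr M borel (\<lambda>\<omega>. \<xi> (s + t) \<omega> - \<xi> s \<omega>) = distr M borel (\<xi> t)"
  using sub by (auto simp: subordinator_def mono_on_def)

lemma xi_nonneg: "\<omega> \<in> space M \<Longrightarrow> 0 \<le> t \<Longrightarrow> 0 \<le> \<xi> t \<omega>"
  using xi_mono[of \<omega> 0 t] xi_0[of \<omega>] by simp

text \<open>Right continuity makes the process a limit of processes that are constant in time on
  grid cells. The \<open>+ 1\<close> after the floor puts the grid point strictly to the right of
  \<open>t\<close>; \<open>max 0\<close> extends the process to negative times, where nothing is
  assumed about it.\<close>

lemma xi_measurable_pair [measurable]:
  "(\<lambda>z. \<xi> (max 0 (fst z)) (snd z)) \<in> borel_measurable (borel \<Otimes>\<^sub>M M)"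
proof (rule borel_measurable_LIMSEQ_real)
  let ?k = "\<lambda>n t. \<lfloor>max 0 t * real (Suc n)\<rfloor>"
  let ?t = "\<lambda>n t. (real_of_int (?k n t) + 1) / real (Suc n)"
  show "(\<lambda>z. \<xi> (max 0 (?t n (fst z))) (snd z)) \<in> borel_measurable (borel \<Otimes>\<^sub>M M)" for n
  proof (rule measurable_compose_countable[where f = "\<lambda>k z. \<xi> (max 0 ((real_of_int k + 1) / real (Suc n))) (snd z)" and g = "\<lambda>z. ?k n (fst z)"])
    show "(\<lambda>z. \<xi> (max 0 ((real_of_int k + 1) / real (Suc n))) (snd z)) \<in> borel_measurable (borel \<Otimes>\<^sub>M M)" for k
      by (rule measurable_compose[OF measurable_snd xi_measurable]) simp
  qed measurable
  fix z :: "real \<times> 'a" assume "z \<in> space (borel \<Otimes>\<^sub>M M)"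
  then have w: "snd z \<in> space M" by (auto simp: space_pair_measure)
  define t where "t = max 0 (fst z)"
  have t: "t \<ge> 0" by (simp add: t_def)
  have gt: "t < ?t n (fst z)" and le: "?t n (fst z) \<le> t + 1 / real (Suc n)" for n
  proof -
    have "t * real (Suc n) < real_of_int (?k n (fst z)) + 1" "real_of_int (?k n (fst z)) \<le> t * real (Suc n)"
      unfolding t_def by linarith+
    then show "t < ?t n (fst z)" "?t n (fst z) \<le> t + 1 / real (Suc n)"
      by (auto simp: field_simps simp del: of_nat_Suc)
  qed
  have "(\<lambda>n. ?t n (fst z)) \<longlonglongrightarrow> t"
  proof (rule tendsto_sandwich[where f = "\<lambda>_. t" and h = "\<lambda>n. t + 1 / real (Suc n)"])
    show "(\<lambda>n. t + 1 / real (Suc n)) \<longlonglongrightarrow> t"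
      using tendsto_add[OF tendsto_const LIMSEQ_inverse_real_of_nat, of t] by (simp add: inverse_eq_divide)
    show "\<forall>\<^sub>F n in sequentially. t \<le> ?t n (fst z)"
      using gt by (intro always_eventually allI less_imp_le)
    show "\<forall>\<^sub>F n in sequentially. ?t n (fst z) \<le> t + 1 / real (Suc n)"
      using le by (intro always_eventually allI)
  qed (rule tendsto_const)
  then have "filterlim (\<lambda>n. ?t n (fst z)) (at_right t) sequentially"
    using gt unfolding filterlim_at by (intro conjI always_eventually allI) auto
  moreover have "((\<lambda>s. \<xi> s (snd z)) \<longlongrightarrow> \<xi> t (snd z)) (at_right t)"
    using xi_right_continuous[OF w t] by (simp add: continuous_within)
  ultimately have "(\<lambda>n. \<xi> (?t n (fst z)) (snd z)) \<longlonglongrightarrow> \<xi> t (snd z)"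
    by (rule filterlim_compose[rotated])
  moreover have "max 0 (?t n (fst z)) = ?t n (fst z)" for n
    using gt[of n] t by linarith
  ultimately show "(\<lambda>n. \<xi> (max 0 (?t n (fst z))) (snd z)) \<longlonglongrightarrow> \<xi> (max 0 (fst z)) (snd z)"
    by (simp only: t_def)
qed

lemma xi_measurable_compose:
  assumes [measurable]: "f \<in> borel_measurable N" "g \<in> measurable N M"
  shows "(\<lambda>x. \<xi> (max 0 (f x)) (g x)) \<in> borel_measurable N"
  using measurable_compose[OF _ xi_measurable_pair, of "\<lambda>x. (f x, g x)" N] by simp

lemma xi_path_measurable [measurable]: "\<omega> \<in> space M \<Longrightarrow> (\<lambda>l. \<xi> (max 0 l) \<omega>) \<in> borel_measurable borel"
  by (rule xi_measurable_compose) auto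

definition riemann_sum :: "nat \<Rightarrow> real \<Rightarrow> real \<Rightarrow> 'a \<Rightarrow> ennreal" where
  "riemann_sum N d s \<omega> = ennreal (\<Sum>k=1..N. d * exp (- (\<xi> (s + real k * d) \<omega> - \<xi> s \<omega>)))"

text \<open>The sum is a function of the increments over a grid of mesh \<open>d\<close> started at \<open>s\<close>, which are independent
  of \<open>\<xi> s\<close> and whose joint law does not depend on \<open>s\<close>.\<close>

lemma nn_integral_riemann_sum_indep:
  fixes \<psi> :: "real \<Rightarrow> ennreal" and a :: ennreal
  assumes [measurable]: "\<psi> \<in> borel_measurable borel" and s: "0 \<le> s" and d: "0 \<le> d"
  shows "(\<integral>\<^sup>+\<omega>. \<psi> (\<xi> s \<omega>) * indicator {a<..} (riemann_sum (Suc N) d s \<omega>) \<partial>M)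
    = (\<integral>\<^sup>+\<omega>. \<psi> (\<xi> s \<omega>) \<partial>M) * (\<integral>\<^sup>+\<omega>. indicator {a<..} (riemann_sum (Suc N) d 0 \<omega>) \<partial>M)"
proof -
  let ?R = "riemann_sum (Suc N) d"
  \<comment> \<open>Time 0 is put before the grid \<open>s, s + d, ...\<close>: increment 0 is then
    \<open>\<xi> s\<close> itself, and the increments with index in \<open>B\<close> are those of
    the grid, whose partial sums \<open>F\<close> reads.\<close>
  define ts where "ts s i = (if i = 0 then 0 else s + real (i - 1) * d)" for s i
  define X where "X s i \<omega> = \<xi> (ts s (Suc i)) \<omega> - \<xi> (ts s i) \<omega>" for s i \<omega>
  \<comment> \<open>Counting up to \<open>Suc N\<close> keeps this index set nonempty, as the
    product-law characterisation of independence requires.\<close>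
  define B where "B = {1..Suc N}"
  define F where "F x = ennreal (\<Sum>k=1..Suc N. d * exp (- (\<Sum>i=1..k. x i)))" for x :: "nat \<Rightarrow> real"
  have ts: "0 \<le> ts s 0" "incseq (ts s)" if "0 \<le> s" for s
    using that d by (auto simp: ts_def incseq_Suc_iff intro!: add_left_mono mult_right_mono)
  have ind: "indep_vars (\<lambda>_. borel) (X s) {..<Suc (Suc N)}" if "0 \<le> s" for s
    unfolding X_def using xi_indep[OF ts[OF that]] by blast
  have XB: "distr M (PiM B (\<lambda>_. borel)) (\<lambda>\<omega>. restrict (\<lambda>i. X s i \<omega>) B) = PiM B (\<lambda>_. distr M borel (\<xi> d))"
    and XBm: "(\<lambda>\<omega>. restrict (\<lambda>i. X s i \<omega>) B) \<in> measurable M (PiM B (\<lambda>_. borel))" if "0 \<le> s" for s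
  proof -
    have iB: "indep_vars (\<lambda>_. borel) (X s) B"
      by (rule indep_vars_subset[OF ind[OF that]]) (auto simp: B_def)
    then have rv: "random_variable borel (X s i)" if "i \<in> B" for i
      using that by (auto simp: indep_vars_def)
    then show "(\<lambda>\<omega>. restrict (\<lambda>i. X s i \<omega>) B) \<in> measurable M (PiM B (\<lambda>_. borel))"
      by (intro measurable_restrict) auto
    have "distr M borel (X s i) = distr M borel (\<xi> d)" if "i \<in> B" for i
    proof -
      have "ts s (Suc i) = ts s i + d" "0 \<le> ts s i"
        using that \<open>0 \<le> s\<close> d by (cases i; auto simp: ts_def B_def algebra_simps)+
      then show ?thesis unfolding X_def using xi_stationary[of "ts s i" d] d by simp
    qed
    moreover have "distr M (PiM B (\<lambda>_. borel)) (\<lambda>\<omega>. restrict (\<lambda>i. X s i \<omega>) B) = PiM B (\<lambda>i. distr M borel (X s i))"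
      using iB rv by (subst indep_vars_iff_distr_eq_PiM'[symmetric]) (auto simp: B_def)
    ultimately show "distr M (PiM B (\<lambda>_. borel)) (\<lambda>\<omega>. restrict (\<lambda>i. X s i \<omega>) B) = PiM B (\<lambda>_. distr M borel (\<xi> d))"
      by (simp cong: PiM_cong)
  qed
  have Fm[measurable]: "F \<in> borel_measurable (PiM B (\<lambda>_. borel))"
  proof -
    have "(\<lambda>x. x i) \<in> borel_measurable (PiM B (\<lambda>_. borel))" if "i \<in> {1..k}" "k \<in> {1..Suc N}" for i k
      using that by (intro measurable_component_singleton) (auto simp: B_def)
    then show ?thesis
      unfolding F_def by (intro measurable_compose[OF _ measurable_ennreal] borel_measurable_sum
        borel_measurable_times borel_measurable_const measurable_compose[OF _ borel_measurable_exp] borel_measurable_uminus) auto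
  qed
  have RF: "?R s \<omega> = F (restrict (\<lambda>i. X s i \<omega>) B)" if "0 \<le> s" for s \<omega>
  proof -
    have "(\<Sum>i=1..k. restrict (\<lambda>i. X s i \<omega>) B i) = \<xi> (s + real k * d) \<omega> - \<xi> s \<omega>" if "k \<in> {1..Suc N}" for k
    proof -
      have "(\<Sum>i=1..k. restrict (\<lambda>i. X s i \<omega>) B i) = (\<Sum>i=1..k. X s i \<omega>)"
        using that by (intro sum.cong) (auto simp: B_def)
      also have "\<dots> = (\<Sum>i=1..k. \<xi> (s + real i * d) \<omega> - \<xi> (s + real (i - 1) * d) \<omega>)"
        by (intro sum.cong) (auto simp: X_def ts_def)
      also have "\<dots> = \<xi> (s + real k * d) \<omega> - \<xi> s \<omega>"
        by (induction k) auto
      finally show ?thesis .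
    qed
    then show ?thesis unfolding riemann_sum_def F_def by (intro arg_cong[where f = ennreal] sum.cong) auto
  qed
  \<comment> \<open>The right-hand side does not mention \<open>s\<close>; using it at
    \<open>s\<close> and at 0 transfers the law to the unshifted sum.\<close>
  have law: "(\<integral>\<^sup>+\<omega>. indicator {a<..} (?R s \<omega>) \<partial>M) = (\<integral>\<^sup>+x. indicator {a<..} (F x) \<partial>PiM B (\<lambda>_. distr M borel (\<xi> d)))"
    if "0 \<le> s" for s
    unfolding XB[OF that, symmetric] RF[OF that] using XBm[OF that]
    by (subst nn_integral_distr) auto
  have "indep_var (PiM {0} (\<lambda>_. borel)) (\<lambda>\<omega>. restrict (\<lambda>i. X s i \<omega>) {0}) (PiM B (\<lambda>_. borel)) (\<lambda>\<omega>. restrict (\<lambda>i. X s i \<omega>) B)"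
    by (rule indep_var_restrict[OF ind[OF s]]) (auto simp: B_def)
  then have "(\<integral>\<^sup>+\<omega>. \<psi> (restrict (\<lambda>i. X s i \<omega>) {0} 0) * indicator {a<..} (F (restrict (\<lambda>i. X s i \<omega>) B)) \<partial>M)
     = (\<integral>\<^sup>+\<omega>. \<psi> (restrict (\<lambda>i. X s i \<omega>) {0} 0) \<partial>M) * (\<integral>\<^sup>+\<omega>. indicator {a<..} (F (restrict (\<lambda>i. X s i \<omega>) B)) \<partial>M)"
    by (rule nn_integral_indep_mult[where f = "\<lambda>x. \<psi> (x 0)" and g = "\<lambda>x. indicator {a<..} (F x)"]) measurable
  moreover have "restrict (\<lambda>i. X s i \<omega>) {0} 0 = \<xi> s \<omega>" if "\<omega> \<in> space M" for \<omega>
    using that xi_0 by (simp add: X_def ts_def)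
  ultimately have "(\<integral>\<^sup>+\<omega>. \<psi> (\<xi> s \<omega>) * indicator {a<..} (?R s \<omega>) \<partial>M)
    = (\<integral>\<^sup>+\<omega>. \<psi> (\<xi> s \<omega>) \<partial>M) * (\<integral>\<^sup>+\<omega>. indicator {a<..} (?R s \<omega>) \<partial>M)"
    by (simp add: RF[OF s] cong: nn_integral_cong)
  then show ?thesis using law[of 0] law[OF s] by simp
qed

section \<open>Tail integrals and the restarted process\<close>

definition tail :: "real \<Rightarrow> 'a \<Rightarrow> ennreal" where
  "tail s \<omega> = (\<integral>\<^sup>+l. ennreal (exp (- \<xi> (max 0 l) \<omega>)) * indicator {s..} l \<partial>lborel)"

text \<open>The exponential functional of the process restarted at time \<open>s\<close>. It takes
  values in \<open>ennreal\<close> because its finiteness, which holds only almost everywhere, is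
  settled later.\<close>

definition shifted :: "real \<Rightarrow> 'a \<Rightarrow> ennreal" where
  "shifted s \<omega> = (\<integral>\<^sup>+l. ennreal (exp (- (\<xi> (s + max 0 l) \<omega> - \<xi> s \<omega>))) * indicator {0..} l \<partial>lborel)"

lemma expfun_eq_tail: "expfun \<xi> \<omega> = enn2real (tail 0 \<omega>)"
  unfolding expfun_def tail_def
  by (intro arg_cong[where f = enn2real] nn_integral_cong) (auto simp: indicator_def)

lemma shifted_0: "\<omega> \<in> space M \<Longrightarrow> shifted 0 \<omega> = tail 0 \<omega>"
  by (simp add: shifted_def tail_def xi_0)

lemma tail_measurable_pair [measurable]: "(\<lambda>z. tail (fst z) (snd z)) \<in> borel_measurable (borel \<Otimes>\<^sub>M M)"
proof -
  have [measurable]: "(\<lambda>z. \<xi> (max 0 (snd z)) (snd (fst z))) \<in> borel_measurable (((borel :: real measure) \<Otimes>\<^sub>M M) \<Otimes>\<^sub>M lborel)"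
    by (rule xi_measurable_compose) measurable
  have [measurable]: "Measurable.pred ((borel \<Otimes>\<^sub>M M) \<Otimes>\<^sub>M lborel) (\<lambda>z :: (real \<times> 'a) \<times> real. snd z \<in> {fst (fst z)..})"
    unfolding atLeast_iff by measurable
  show ?thesis unfolding tail_def by measurable
qed

lemma tail_measurable [measurable]: "tail s \<in> borel_measurable M"
  using measurable_compose[OF _ tail_measurable_pair, of "\<lambda>\<omega>. (s, \<omega>)" M] by simp

lemma shifted_path:
  assumes "\<omega> \<in> space M" "0 \<le> s"
  shows "(\<lambda>l. \<xi> (s + max 0 l) \<omega>) \<in> borel_measurable borel"
proof -
  have "(\<lambda>l. \<xi> (max 0 (s + max 0 l)) \<omega>) \<in> borel_measurable borel"
    by (rule xi_measurable_compose) (use assms in auto)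
  then show ?thesis using assms by (simp add: max_def cong: if_cong)
qed

lemma tail_eq_shifted:
  assumes w: "\<omega> \<in> space M" and s: "0 \<le> s"
  shows "tail s \<omega> = ennreal (exp (- \<xi> s \<omega>)) * shifted s \<omega>"
proof -
  note [measurable] = xi_path_measurable[OF w] shifted_path[OF w s]
  have "tail s \<omega> = (\<integral>\<^sup>+l. ennreal (exp (- \<xi> (max 0 (s + 1 * l)) \<omega>)) * indicator {s..} (s + 1 * l) \<partial>lborel)"
    unfolding tail_def by (subst nn_integral_real_affine[where c = 1 and t = s]) auto
  also have "\<dots> = (\<integral>\<^sup>+l. ennreal (exp (- \<xi> s \<omega>)) * (ennreal (exp (- (\<xi> (s + max 0 l) \<omega> - \<xi> s \<omega>))) * indicator {0..} l) \<partial>lborel)"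
  proof (rule nn_integral_cong)
    fix l
    show "ennreal (exp (- \<xi> (max 0 (s + 1 * l)) \<omega>)) * indicator {s..} (s + 1 * l)
      = ennreal (exp (- \<xi> s \<omega>)) * (ennreal (exp (- (\<xi> (s + max 0 l) \<omega> - \<xi> s \<omega>))) * indicator {0..} l)"
      using s by (cases "l \<ge> 0") (auto simp: indicator_def max_def ennreal_mult[symmetric] simp flip: exp_add)
  qed
  also have "\<dots> = ennreal (exp (- \<xi> s \<omega>)) * shifted s \<omega>"
    unfolding shifted_def by (rule nn_integral_cmult) measurable
  finally show ?thesis .
qed

text \<open>Multiplying the tail by \<open>exp (\<xi> s)\<close> undoes the factorisation, so joint
  measurability need not be repeated for the restarted process.\<close>

lemma shifted_measurable:
  assumes s: "0 \<le> s"
  shows "shifted s \<in> borel_measurable M"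
proof -
  note [measurable] = xi_measurable[OF s]
  have "(\<lambda>\<omega>. ennreal (exp (\<xi> s \<omega>)) * tail s \<omega>) \<in> borel_measurable M" by measurable
  also have "?this \<longleftrightarrow> ?thesis"
    by (rule measurable_cong)
       (simp add: tail_eq_shifted[OF _ s] mult.assoc[symmetric] ennreal_mult[symmetric] flip: exp_add)
  finally show ?thesis .
qed

lemma riemann_sum_measurable:
  assumes "0 \<le> s" "0 \<le> d"
  shows "riemann_sum N d s \<in> borel_measurable M"
proof -
  have [measurable]: "\<xi> s \<in> borel_measurable M" "\<xi> (s + real k * d) \<in> borel_measurable M" for k
    using assms by (simp_all add: xi_measurable)
  show ?thesis unfolding riemann_sum_def[abs_def] by measurable
qed

text \<open>Approximation from below is essential. If the limit exceeds \<open>a\<close>, the sums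
  eventually do; if it is at most \<open>a\<close>, even with equality, no sum ever enters the open
  ray.\<close>

lemma riemann_sum_indicator_tendsto:
  assumes w: "\<omega> \<in> space M" and s: "0 \<le> s"
  shows "(\<lambda>n. indicator {a<..} (riemann_sum (Suc n * Suc n) (1 / real (Suc n)) s \<omega>) :: ennreal)
    \<longlonglongrightarrow> indicator {a<..} (shifted s \<omega>)"
proof -
  define h where "h u = exp (- (\<xi> (s + max 0 u) \<omega> - \<xi> s \<omega>))" for u
  have [measurable]: "h \<in> borel_measurable borel"
    unfolding h_def[abs_def] using shifted_path[OF w s] by measurable
  have dec: "h v \<le> h u" if "0 \<le> u" "u \<le> v" for u v
    using that s xi_mono[OF w] by (simp add: h_def)
  have nonneg: "0 \<le> h u" for u by (simp add: h_def)
  have R: "riemann_sum (Suc n * Suc n) (1 / real (Suc n)) s \<omega>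
      = ennreal (\<Sum>k=1..Suc n * Suc n. 1 / real (Suc n) * h (real k * (1 / real (Suc n))))" for n
    unfolding riemann_sum_def h_def by (intro arg_cong[where f = ennreal] sum.cong) auto
  have S: "shifted s \<omega> = (\<integral>\<^sup>+u. ennreal (h u) * indicator {0..} u \<partial>lborel)"
    by (simp add: shifted_def h_def)
  show ?thesis
  proof (cases "a < shifted s \<omega>")
    case True
    then have "\<forall>\<^sub>F n in sequentially. a < riemann_sum (Suc n * Suc n) (1 / real (Suc n)) s \<omega>"
      unfolding R S by (intro eventually_less_riemann_sum dec nonneg) measurable
    then have "\<forall>\<^sub>F n in sequentially. indicator {a<..} (riemann_sum (Suc n * Suc n) (1 / real (Suc n)) s \<omega>)
        = (indicator {a<..} (shifted s \<omega>) :: ennreal)"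
      by eventually_elim (use True in auto)
    then show ?thesis by (rule tendsto_eventually)
  next
    case False
    have "riemann_sum (Suc n * Suc n) (1 / real (Suc n)) s \<omega> \<le> shifted s \<omega>" for n
    proof -
      have "riemann_sum (Suc n * Suc n) (1 / real (Suc n)) s \<omega>
          \<le> (\<integral>\<^sup>+u. ennreal (h u) * indicator {0<..real (Suc n * Suc n) * (1 / real (Suc n))} u \<partial>lborel)"
        unfolding R by (rule riemann_sum_le_nn_integral) (use dec nonneg in auto)
      also have "\<dots> \<le> shifted s \<omega>"
        unfolding S by (intro nn_integral_mono) (auto simp: indicator_def)
      finally show ?thesis .
    qed
    then have "indicator {a<..} (riemann_sum (Suc n * Suc n) (1 / real (Suc n)) s \<omega>)
        = (indicator {a<..} (shifted s \<omega>) :: ennreal)" for n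
      using False by (auto simp: indicator_def not_less simp del: mult_Suc mult_Suc_right of_nat_Suc intro: order_trans)
    then show ?thesis by (simp only: tendsto_const)
  qed
qed

text \<open>The factorisation for Riemann sums passes to the limit by dominated convergence.
  Finiteness of the mean of \<open>\<psi> (\<xi> s)\<close> supplies the majorant and allows the
  limit to be multiplied by that mean.\<close>

lemma nn_integral_indicator_shifted_indep:
  fixes \<psi> :: "real \<Rightarrow> ennreal" and a :: ennreal
  assumes [measurable]: "\<psi> \<in> borel_measurable borel" and s: "0 \<le> s"
    and fin: "(\<integral>\<^sup>+\<omega>. \<psi> (\<xi> s \<omega>) \<partial>M) < \<infinity>"
  shows "(\<integral>\<^sup>+\<omega>. \<psi> (\<xi> s \<omega>) * indicator {a<..} (shifted s \<omega>) \<partial>M)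
    = (\<integral>\<^sup>+\<omega>. \<psi> (\<xi> s \<omega>) \<partial>M) * (\<integral>\<^sup>+\<omega>. indicator {a<..} (tail 0 \<omega>) \<partial>M)"
proof -
  let ?R = "\<lambda>n s. riemann_sum (Suc n * Suc n) (1 / real (Suc n)) s"
  note [measurable] = xi_measurable[OF s] shifted_measurable
  have Rm[measurable]: "?R n t \<in> borel_measurable M" if "0 \<le> t" for n t
    using that by (intro riemann_sum_measurable) auto
  have lim: "(\<lambda>n. \<integral>\<^sup>+\<omega>. f (\<xi> t \<omega>) * indicator {a<..} (?R n t \<omega>) \<partial>M)
      \<longlonglongrightarrow> (\<integral>\<^sup>+\<omega>. f (\<xi> t \<omega>) * indicator {a<..} (shifted t \<omega>) \<partial>M)"
    if t: "0 \<le> t" and f: "f \<in> borel_measurable borel" "(\<integral>\<^sup>+\<omega>. f (\<xi> t \<omega>) \<partial>M) < \<infinity>" for t and f :: "real \<Rightarrow> ennreal"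
  proof (rule nn_integral_dominated_convergence[where w = "\<lambda>\<omega>. f (\<xi> t \<omega>)"])
    note [measurable] = xi_measurable[OF t] shifted_measurable[OF t] Rm[OF t] f(1)
    show "(\<lambda>\<omega>. f (\<xi> t \<omega>) * indicator {a<..} (?R n t \<omega>)) \<in> borel_measurable M" for n by measurable
    show "(\<lambda>\<omega>. f (\<xi> t \<omega>) * indicator {a<..} (shifted t \<omega>)) \<in> borel_measurable M" by measurable
    show "(\<lambda>\<omega>. f (\<xi> t \<omega>)) \<in> borel_measurable M" by measurable
    show "AE \<omega> in M. f (\<xi> t \<omega>) * indicator {a<..} (?R n t \<omega>) \<le> f (\<xi> t \<omega>)" for n
      by (auto simp: indicator_def)
    have "AE \<omega> in M. f (\<xi> t \<omega>) \<noteq> \<infinity>" using f(2) by (intro nn_integral_PInf_AE) auto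
    then show "AE \<omega> in M. (\<lambda>n. f (\<xi> t \<omega>) * indicator {a<..} (?R n t \<omega>))
        \<longlonglongrightarrow> f (\<xi> t \<omega>) * indicator {a<..} (shifted t \<omega>)"
      using AE_space
    proof eventually_elim
      case (elim \<omega>)
      then show ?case
        by (intro ennreal_tendsto_cmult riemann_sum_indicator_tendsto t) (auto simp: less_top)
    qed
  qed (use f in auto)
  have "(\<lambda>n. \<integral>\<^sup>+\<omega>. \<psi> (\<xi> s \<omega>) * indicator {a<..} (?R n s \<omega>) \<partial>M)
      \<longlonglongrightarrow> (\<integral>\<^sup>+\<omega>. \<psi> (\<xi> s \<omega>) * indicator {a<..} (shifted s \<omega>) \<partial>M)"
    by (rule lim[OF s assms(1) fin])
  moreover have "(\<integral>\<^sup>+\<omega>. \<psi> (\<xi> s \<omega>) * indicator {a<..} (?R n s \<omega>) \<partial>M)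
      = (\<integral>\<^sup>+\<omega>. \<psi> (\<xi> s \<omega>) \<partial>M) * (\<integral>\<^sup>+\<omega>. indicator {a<..} (?R n 0 \<omega>) \<partial>M)" for n
    using nn_integral_riemann_sum_indep[OF assms(1) s, of "1 / real (Suc n)" a "n + n * Suc n"] by simp
  moreover have "(\<lambda>n. \<integral>\<^sup>+\<omega>. indicator {a<..} (?R n 0 \<omega>) \<partial>M) \<longlonglongrightarrow> (\<integral>\<^sup>+\<omega>. indicator {a<..} (shifted 0 \<omega>) \<partial>M)"
    using lim[of 0 "\<lambda>_. 1"] by (simp add: emeasure_space_1)
  then have "(\<lambda>n. (\<integral>\<^sup>+\<omega>. \<psi> (\<xi> s \<omega>) \<partial>M) * (\<integral>\<^sup>+\<omega>. indicator {a<..} (?R n 0 \<omega>) \<partial>M))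
     \<longlonglongrightarrow> (\<integral>\<^sup>+\<omega>. \<psi> (\<xi> s \<omega>) \<partial>M) * (\<integral>\<^sup>+\<omega>. indicator {a<..} (shifted 0 \<omega>) \<partial>M)"
    using fin by (intro ennreal_tendsto_cmult) auto
  ultimately have "(\<integral>\<^sup>+\<omega>. \<psi> (\<xi> s \<omega>) * indicator {a<..} (shifted s \<omega>) \<partial>M)
    = (\<integral>\<^sup>+\<omega>. \<psi> (\<xi> s \<omega>) \<partial>M) * (\<integral>\<^sup>+\<omega>. indicator {a<..} (shifted 0 \<omega>) \<partial>M)"
    by (simp add: LIMSEQ_unique)
  also have "(\<integral>\<^sup>+\<omega>. indicator {a<..} (shifted 0 \<omega>) \<partial>M) = (\<integral>\<^sup>+\<omega>. (indicator {a<..} (tail 0 \<omega>) :: ennreal) \<partial>M)"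
    by (intro nn_integral_cong) (simp add: shifted_0)
  finally show ?thesis .
qed

text \<open>Weighting the probability by \<open>\<psi> (\<xi> s)\<close> gives the restarted
  functional the law of the original one, scaled by the mean of the weight. These finite measures
  agree on rays, hence everywhere.\<close>

lemma nn_integral_shifted_indep:
  fixes \<psi> \<phi> :: "real \<Rightarrow> ennreal"
  assumes [measurable]: "\<psi> \<in> borel_measurable borel" "\<phi> \<in> borel_measurable borel" and s: "0 \<le> s"
    and fin: "(\<integral>\<^sup>+\<omega>. \<psi> (\<xi> s \<omega>) \<partial>M) < \<infinity>"
    and AE_fin: "AE \<omega> in M. tail 0 \<omega> < \<infinity>"
  shows "(\<integral>\<^sup>+\<omega>. \<psi> (\<xi> s \<omega>) * \<phi> (enn2real (shifted s \<omega>)) \<partial>M)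
    = (\<integral>\<^sup>+\<omega>. \<psi> (\<xi> s \<omega>) \<partial>M) * (\<integral>\<^sup>+\<omega>. \<phi> (expfun \<xi> \<omega>) \<partial>M)"
proof -
  note [measurable] = xi_measurable[OF s] shifted_measurable[OF s]
  let ?c = "\<integral>\<^sup>+\<omega>. \<psi> (\<xi> s \<omega>) \<partial>M"
  \<comment> \<open>\<open>enn2real\<close> sends infinity to 0, so replacing a ray in the reals by
    a ray in \<open>ennreal\<close> requires finite values.\<close>
  have AE_fin_s: "AE \<omega> in M. shifted s \<omega> < \<infinity>"
    using AE_fin AE_space
  proof eventually_elim
    case (elim \<omega>)
    have "tail s \<omega> \<le> tail 0 \<omega>"
      unfolding tail_def using s by (intro nn_integral_mono) (auto simp: indicator_def)
    with elim have "ennreal (exp (- \<xi> s \<omega>)) * shifted s \<omega> < \<infinity>"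
      by (simp add: tail_eq_shifted[OF _ s])
    then show ?case by (auto simp: ennreal_mult_less_top)
  qed
  have gt: "{x<..} = {y. x < y}" for x :: real by auto
  have eq: "distr (density M (\<lambda>\<omega>. \<psi> (\<xi> s \<omega>))) borel (\<lambda>\<omega>. enn2real (shifted s \<omega>))
    = distr (density M (\<lambda>\<omega>. ?c)) borel (\<lambda>\<omega>. enn2real (tail 0 \<omega>))" (is "?N1 = ?N2")
  proof (rule measure_eqI_lessThan)
    fix x :: real
    have N1: "emeasure ?N1 {x<..} = (\<integral>\<^sup>+\<omega>. \<psi> (\<xi> s \<omega>) * indicator {x<..} (enn2real (shifted s \<omega>)) \<partial>M)"
      by (subst nn_integral_indicator[symmetric], simp, subst nn_integral_distr) (simp_all add: nn_integral_density)
    have N2: "emeasure ?N2 {x<..} = (\<integral>\<^sup>+\<omega>. ?c * indicator {x<..} (enn2real (tail 0 \<omega>)) \<partial>M)"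
      by (subst nn_integral_indicator[symmetric], simp, subst nn_integral_distr) (simp_all add: nn_integral_density)
    have "emeasure ?N1 {x<..} \<le> ?c"
      unfolding N1 by (intro nn_integral_mono) (auto simp: indicator_def)
    then show "emeasure ?N1 {x<..} < \<infinity>" using fin by (rule le_less_trans)
    show "emeasure ?N1 {x<..} = emeasure ?N2 {x<..}"
    proof (cases "x < 0")
      case True
      then have "x < enn2real y" for y using enn2real_nonneg[of y] by linarith
      then show ?thesis unfolding N1 N2 by (simp add: emeasure_space_1)
    next
      case False
      have ind: "(indicator {x<..} (enn2real y) :: ennreal) = indicator {ennreal x<..} y" if "y < \<infinity>" for y
        using that False by (cases y) (auto simp: indicator_def ennreal_less_iff)
      have "emeasure ?N1 {x<..} = (\<integral>\<^sup>+\<omega>. \<psi> (\<xi> s \<omega>) * indicator {ennreal x<..} (shifted s \<omega>) \<partial>M)"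
        unfolding N1 by (rule nn_integral_cong_AE) (use AE_fin_s in eventually_elim, simp add: ind)
      also have "\<dots> = ?c * (\<integral>\<^sup>+\<omega>. indicator {ennreal x<..} (tail 0 \<omega>) \<partial>M)"
        by (rule nn_integral_indicator_shifted_indep[OF assms(1) s fin])
      also have "\<dots> = (\<integral>\<^sup>+\<omega>. ?c * indicator {ennreal x<..} (tail 0 \<omega>) \<partial>M)"
        by (rule nn_integral_cmult[symmetric]) measurable
      also have "\<dots> = emeasure ?N2 {x<..}"
        unfolding N2 by (rule nn_integral_cong_AE) (use AE_fin in eventually_elim, simp add: ind)
      finally show ?thesis .
    qed
  qed auto
  have "(\<integral>\<^sup>+\<omega>. \<psi> (\<xi> s \<omega>) * \<phi> (enn2real (shifted s \<omega>)) \<partial>M) = (\<integral>\<^sup>+x. \<phi> x \<partial>?N1)"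
    by (simp add: nn_integral_distr nn_integral_density)
  also have "\<dots> = (\<integral>\<^sup>+\<omega>. ?c * \<phi> (enn2real (tail 0 \<omega>)) \<partial>M)"
    unfolding eq by (simp add: nn_integral_distr nn_integral_density)
  also have "\<dots> = ?c * (\<integral>\<^sup>+\<omega>. \<phi> (expfun \<xi> \<omega>) \<partial>M)"
    unfolding expfun_eq_tail by (rule nn_integral_cmult) measurable
  finally show ?thesis .
qed

end

subsection \<open>Moments of the exponential functional\<close>

locale subordinator_exponent = subordinator_process M \<xi>
  for M :: "'a measure" and \<xi> :: "real \<Rightarrow> 'a \<Rightarrow> real" +
  fixes \<Phi> :: "real \<Rightarrow> real"
  assumes Phi: "\<And>l s. 0 \<le> l \<Longrightarrow> 0 \<le> s \<Longrightarrow> expectation (\<lambda>\<omega>. exp (- s * \<xi> l \<omega>)) = exp (- l * \<Phi> s)"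
    and Phi_nz: "\<exists>s\<ge>0. \<Phi> s \<noteq> 0"
begin

lemma Phi_pos: "0 < s \<Longrightarrow> 0 < \<Phi> s"
  and Phi_deriv: "0 < s \<Longrightarrow> (\<Phi> has_real_derivative deriv \<Phi> s) (at s)"
  and Phi_deriv_nonneg: "0 < s \<Longrightarrow> 0 \<le> deriv \<Phi> s"
  and Phi_deriv_le: "0 < s \<Longrightarrow> s * deriv \<Phi> s \<le> \<Phi> s"
proof -
  obtain q where q: "0 \<le> q" "\<Phi> q \<noteq> 0" using Phi_nz by blast
  have LT: "expectation (\<lambda>\<omega>. exp (- s * \<xi> 1 \<omega>)) = exp (- \<Phi> s)" if "0 \<le> s" for s
    using Phi[of 1 s] that by simp
  note L = laplace_exponent[OF xi_measurable[OF zero_le_one] xi_nonneg[OF _ zero_le_one] LT q]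
  show "0 < s \<Longrightarrow> 0 < \<Phi> s" "0 < s \<Longrightarrow> (\<Phi> has_real_derivative deriv \<Phi> s) (at s)"
    "0 < s \<Longrightarrow> 0 \<le> deriv \<Phi> s" "0 < s \<Longrightarrow> s * deriv \<Phi> s \<le> \<Phi> s"
    using L by auto
qed

lemma nn_integral_exp_xi:
  assumes "0 \<le> l" "0 \<le> s"
  shows "(\<integral>\<^sup>+\<omega>. ennreal (exp (- s * \<xi> l \<omega>)) \<partial>M) = ennreal (exp (- l * \<Phi> s))"
proof -
  have "(\<integral>\<^sup>+\<omega>. ennreal (exp (- s * \<xi> l \<omega>)) \<partial>M) = ennreal (expectation (\<lambda>\<omega>. exp (- s * \<xi> l \<omega>)))"
    by (intro nn_integral_eq_integral integrable_exp_neg xi_measurable xi_nonneg assms) auto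
  then show ?thesis using Phi[OF assms] by simp
qed

lemma pair_sigma_finite_lborel: "pair_sigma_finite (lborel :: real measure) M"
  by unfold_locales

text \<open>Its expectation is the integral of \<open>exp (- l * \<Phi> 1)\<close> over the
  half-line, the finite number \<open>1 / \<Phi> 1\<close>.\<close>

lemma AE_tail_finite: "AE \<omega> in M. tail 0 \<omega> < \<infinity>"
proof -
  interpret pair_sigma_finite "lborel :: real measure" M by (rule pair_sigma_finite_lborel)
  have "(\<integral>\<^sup>+\<omega>. tail 0 \<omega> \<partial>M) = (\<integral>\<^sup>+l. (\<integral>\<^sup>+\<omega>. ennreal (exp (- \<xi> (max 0 l) \<omega>)) * indicator {0..} l \<partial>M) \<partial>lborel)"
    unfolding tail_def by (rule Fubini') (simp add: case_prod_beta')
  also have "\<dots> = (\<integral>\<^sup>+l. ennreal (exp (- l * \<Phi> 1)) * indicator {0..} l \<partial>lborel)"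
  proof (rule nn_integral_cong)
    fix l :: real
    show "(\<integral>\<^sup>+\<omega>. ennreal (exp (- \<xi> (max 0 l) \<omega>)) * indicator {0..} l \<partial>M) = ennreal (exp (- l * \<Phi> 1)) * indicator {0..} l"
      using nn_integral_exp_xi[of l 1] by (cases "l \<ge> 0") auto
  qed
  also have "\<dots> = ennreal (1 / \<Phi> 1)" by (rule nn_integral_exp_neg) (simp add: Phi_pos)
  finally have "(\<integral>\<^sup>+\<omega>. tail 0 \<omega> \<partial>M) \<noteq> \<infinity>" by simp
  then have "AE \<omega> in M. tail 0 \<omega> \<noteq> \<infinity>" by (intro nn_integral_PInf_AE) auto
  then show ?thesis by eventually_elim (simp add: less_top)
qed

lemma expfun_measurable [measurable]: "expfun \<xi> \<in> borel_measurable M"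
  unfolding expfun_eq_tail[abs_def] by measurable

text \<open>The integrand is at least \<open>exp (- \<xi> 1)\<close> on \<open>{0..1}\<close>.
  Finiteness matters too, because an infinite integral would be read as 0.\<close>

lemma AE_expfun_pos: "AE \<omega> in M. 0 < expfun \<xi> \<omega>"
  using AE_tail_finite AE_space
proof eventually_elim
  case (elim \<omega>)
  have "0 < ennreal (exp (- \<xi> 1 \<omega>)) * emeasure lborel {0..1::real}" by simp
  also have "\<dots> = (\<integral>\<^sup>+l. ennreal (exp (- \<xi> 1 \<omega>)) * indicator {0..1::real} l \<partial>lborel)"
    by (rule nn_integral_cmult_indicator[symmetric]) simp
  also have "\<dots> \<le> tail 0 \<omega>"
    unfolding tail_def using xi_mono[OF elim(2)]
    by (intro nn_integral_mono) (auto simp: indicator_def intro!: ennreal_leI)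
  finally show ?case using elim(1) by (auto simp: expfun_eq_tail enn2real_positive_iff)
qed

text \<open>The extended form makes sense before any moment is known to be finite, so it can itself
  be used to prove finiteness.\<close>

lemma nn_moment_plus1:
  assumes r: "0 < r"
  shows "(\<integral>\<^sup>+\<omega>. ennreal (expfun \<xi> \<omega> powr r) \<partial>M) = ennreal (r / \<Phi> r) * (\<integral>\<^sup>+\<omega>. ennreal (expfun \<xi> \<omega> powr (r - 1)) \<partial>M)"
proof -
  interpret pair_sigma_finite "lborel :: real measure" M by (rule pair_sigma_finite_lborel)
  let ?m = "\<integral>\<^sup>+\<omega>. ennreal (expfun \<xi> \<omega> powr (r - 1)) \<partial>M"
  let ?G = "\<lambda>s \<omega>. exp (- \<xi> (max 0 s) \<omega>) * enn2real (tail s \<omega>) powr (r - 1)"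
  have path: "AE \<omega> in M. ennreal (expfun \<xi> \<omega> powr r / r) = (\<integral>\<^sup>+s. ennreal (?G s \<omega>) * indicator {0..} s \<partial>lborel)"
    using AE_tail_finite AE_space
  proof eventually_elim
    case (elim \<omega>)
    show ?case
      unfolding expfun_eq_tail
    proof (rule nn_integral_tail_powr[symmetric])
      show "(\<lambda>s. exp (- \<xi> (max 0 s) \<omega>)) \<in> borel_measurable borel"
        using xi_path_measurable[OF elim(2)] by measurable
    qed (use elim r xi_mono[OF elim(2)] in \<open>auto simp: tail_def\<close>)
  qed
  \<comment> \<open>One factor \<open>exp (- \<xi> s)\<close> comes from the integrand and a power
    \<open>r - 1\<close> from the tail. Together they give \<open>exp (- r * \<xi> s)\<close>, whose
    mean brings in \<open>\<Phi> r\<close>.\<close>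
  have inner: "(\<integral>\<^sup>+\<omega>. ennreal (?G s \<omega>) * indicator {0..} s \<partial>M) = (ennreal (exp (- s * \<Phi> r)) * indicator {0..} s) * ?m" for s
  proof (cases "0 \<le> s")
    case True
    have "(\<integral>\<^sup>+\<omega>. ennreal (?G s \<omega>) \<partial>M) = (\<integral>\<^sup>+\<omega>. ennreal (exp (- r * \<xi> s \<omega>)) * ennreal (enn2real (shifted s \<omega>) powr (r - 1)) \<partial>M)"
    proof (rule nn_integral_cong)
      fix \<omega> assume w: "\<omega> \<in> space M"
      have "?G s \<omega> = exp (- \<xi> s \<omega>) * (exp (- \<xi> s \<omega>) * enn2real (shifted s \<omega>)) powr (r - 1)"
        using True by (simp add: tail_eq_shifted[OF w True] enn2real_mult)
      also have "\<dots> = exp (- \<xi> s \<omega>) * exp (- \<xi> s \<omega>) powr (r - 1) * enn2real (shifted s \<omega>) powr (r - 1)"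
        by (simp add: powr_mult)
      also have "exp (- \<xi> s \<omega>) * exp (- \<xi> s \<omega>) powr (r - 1) = exp (- r * \<xi> s \<omega>)"
        by (simp add: powr_def algebra_simps flip: exp_add)
      finally show "ennreal (?G s \<omega>) = ennreal (exp (- r * \<xi> s \<omega>)) * ennreal (enn2real (shifted s \<omega>) powr (r - 1))"
        by (simp add: ennreal_mult)
    qed
    also have "\<dots> = (\<integral>\<^sup>+\<omega>. ennreal (exp (- r * \<xi> s \<omega>)) \<partial>M) * ?m"
      using nn_integral_exp_xi[OF True, of r] r
      by (intro nn_integral_shifted_indep[where \<psi> = "\<lambda>x. ennreal (exp (- r * x))" and \<phi> = "\<lambda>x. ennreal (x powr (r - 1))"] True AE_tail_finite) auto
    finally show ?thesis using True nn_integral_exp_xi[OF True, of r] r by simp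
  qed simp
  have "ennreal (1 / r) * (\<integral>\<^sup>+\<omega>. ennreal (expfun \<xi> \<omega> powr r) \<partial>M) = (\<integral>\<^sup>+\<omega>. ennreal (expfun \<xi> \<omega> powr r / r) \<partial>M)"
    using r by (subst nn_integral_cmult[symmetric]) (auto simp: ennreal_mult[symmetric])
  also have "\<dots> = (\<integral>\<^sup>+\<omega>. (\<integral>\<^sup>+s. ennreal (?G s \<omega>) * indicator {0..} s \<partial>lborel) \<partial>M)"
    by (rule nn_integral_cong_AE[OF path])
  also have "\<dots> = (\<integral>\<^sup>+s. (\<integral>\<^sup>+\<omega>. ennreal (?G s \<omega>) * indicator {0..} s \<partial>M) \<partial>lborel)"
    by (rule Fubini') (simp add: case_prod_beta')
  also have "\<dots> = ennreal (1 / \<Phi> r) * ?m"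
    unfolding inner using nn_integral_exp_neg[OF Phi_pos[OF r]] by (subst nn_integral_multc) auto
  finally have "ennreal r * (ennreal (1 / r) * (\<integral>\<^sup>+\<omega>. ennreal (expfun \<xi> \<omega> powr r) \<partial>M)) = ennreal r * (ennreal (1 / \<Phi> r) * ?m)"
    by simp
  then show ?thesis
    using r Phi_pos[OF r] by (simp add: mult.assoc[symmetric] ennreal_mult[symmetric])
qed

text \<open>Almost sure positivity enters because \<open>0 powr 0\<close> is 0.\<close>

lemma nn_moment_1: "(\<integral>\<^sup>+\<omega>. ennreal (expfun \<xi> \<omega> powr 0) \<partial>M) = 1"
proof -
  have "(\<integral>\<^sup>+\<omega>. ennreal (expfun \<xi> \<omega> powr 0) \<partial>M) = (\<integral>\<^sup>+\<omega>. 1 \<partial>M)"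
    by (rule nn_integral_cong_AE) (use AE_expfun_pos in eventually_elim, simp)
  then show ?thesis by (simp add: emeasure_space_1)
qed

lemma nn_moment_nat_finite: "(\<integral>\<^sup>+\<omega>. ennreal (expfun \<xi> \<omega> powr real n) \<partial>M) < \<infinity>"
proof (induction n)
  case 0
  then show ?case using nn_moment_1 by simp
next
  case (Suc n)
  then show ?case
    using nn_moment_plus1[of "real (Suc n)"] by (simp add: ennreal_mult_less_top)
qed

lemma integrable_moment:
  assumes "0 < r"
  shows "integrable M (\<lambda>\<omega>. expfun \<xi> \<omega> powr (r - 1))"
proof -
  have ge: "(\<integral>\<^sup>+\<omega>. ennreal (expfun \<xi> \<omega> powr p) \<partial>M) < \<infinity>" if "0 \<le> p" for p
  proof -
    obtain n where n: "p \<le> real n" using real_arch_simple by blast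
    have "(\<integral>\<^sup>+\<omega>. ennreal (expfun \<xi> \<omega> powr p) \<partial>M) \<le> (\<integral>\<^sup>+\<omega>. 1 + ennreal (expfun \<xi> \<omega> powr real n) \<partial>M)"
    proof (rule nn_integral_mono)
      fix \<omega>
      have "expfun \<xi> \<omega> powr p \<le> 1 + expfun \<xi> \<omega> powr real n"
      proof (cases "expfun \<xi> \<omega> \<le> 1")
        case True
        then have "expfun \<xi> \<omega> powr p \<le> 1"
          using that by (intro powr_le1) (auto simp: expfun_def)
        then show ?thesis using powr_ge_zero[of "expfun \<xi> \<omega>" "real n"] by linarith
      next
        case False
        then have "expfun \<xi> \<omega> powr p \<le> expfun \<xi> \<omega> powr real n" by (intro powr_mono n) simp
        then show ?thesis by linarith
      qed
      then show "ennreal (expfun \<xi> \<omega> powr p) \<le> 1 + ennreal (expfun \<xi> \<omega> powr real n)"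
        by (simp add: ennreal_leI flip: ennreal_1 ennreal_plus)
    qed
    also have "\<dots> < \<infinity>"
      using nn_moment_nat_finite[of n] by (subst nn_integral_add) (auto simp: emeasure_space_1)
    finally show ?thesis .
  qed
  \<comment> \<open>The recurrence read backwards: the moment of exponent \<open>r\<close> is finite
    and the factor \<open>r / \<Phi> r\<close> is positive, so the moment of exponent
    \<open>r - 1\<close>, possibly negative, is finite.\<close>
  have "ennreal (r / \<Phi> r) * (\<integral>\<^sup>+\<omega>. ennreal (expfun \<xi> \<omega> powr (r - 1)) \<partial>M) < \<infinity>"
    using ge[of r] nn_moment_plus1[OF assms] assms by simp
  then have "(\<integral>\<^sup>+\<omega>. ennreal (expfun \<xi> \<omega> powr (r - 1)) \<partial>M) < \<infinity>"
    using divide_pos_pos[OF assms Phi_pos[OF assms]] by (auto simp: ennreal_mult_less_top ennreal_eq_0_iff)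
  then show ?thesis by (intro integrableI_nonneg) auto
qed

section \<open>Real-valued moments\<close>

definition moment :: "real \<Rightarrow> real" where
  "moment r = expectation (\<lambda>\<omega>. expfun \<xi> \<omega> powr (r - 1))"

lemma nn_integral_eq_moment:
  "0 < r \<Longrightarrow> (\<integral>\<^sup>+\<omega>. ennreal (expfun \<xi> \<omega> powr (r - 1)) \<partial>M) = ennreal (moment r)"
  unfolding moment_def by (intro nn_integral_eq_integral integrable_moment) auto

lemma expfun_moment_pos: "0 < r \<Longrightarrow> 0 < moment r"
  unfolding moment_def by (rule moment_pos[OF expfun_measurable AE_expfun_pos integrable_moment])

lemma convex_on_ln_expfun_moment: "convex_on {0<..} (\<lambda>r. ln (moment r))"
  unfolding moment_def by (rule convex_on_ln_moment[OF expfun_measurable AE_expfun_pos integrable_moment])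

lemma moment_1: "moment 1 = 1"
proof -
  have "ennreal (moment 1) = ennreal 1"
    using nn_integral_eq_moment[of 1] nn_moment_1 by simp
  then show ?thesis using expfun_moment_pos[of 1] by (subst (asm) ennreal_inj) auto
qed

lemma moment_plus1:
  assumes "0 < r"
  shows "moment (r + 1) = r / \<Phi> r * moment r"
proof -
  have "ennreal (moment (r + 1)) = ennreal (r / \<Phi> r * moment r)"
    using nn_integral_eq_moment[of "r + 1"] nn_integral_eq_moment[of r] nn_moment_plus1[OF assms] assms
      Phi_pos[OF assms] expfun_moment_pos[OF assms]
    by (simp add: ennreal_mult[symmetric])
  then show ?thesis
    using assms Phi_pos[OF assms] expfun_moment_pos[of r] expfun_moment_pos[of "r + 1"]
    by (subst (asm) ennreal_inj) auto
qed

end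

section \<open>Identification with the Gamma function\<close>

theorem theorem3p2:
  fixes M :: "'a measure" and \<xi> :: "real \<Rightarrow> 'a \<Rightarrow> real" and \<Phi> :: "real \<Rightarrow> real"
    and \<kappa> :: "real measure" and r :: real
  assumes sub: "subordinator M \<xi>"
    and Phi: "\<forall>l\<ge>0. \<forall>s\<ge>0. prob_space.expectation M (\<lambda>\<omega>. exp (- s * \<xi> l \<omega>)) = exp (- l * \<Phi> s)"
    and Phi_nz: "\<exists>s\<ge>0. \<Phi> s \<noteq> 0"
    and kappa_sets: "sets \<kappa> = sets borel"
    and kappa_supp: "emeasure \<kappa> {..<0} = 0"
    and kappa_LT: "\<forall>s>0. (\<integral>\<^sup>+ x. ennreal (exp (- s * x)) \<partial>\<kappa>) = ennreal (deriv \<Phi> s / \<Phi> s)"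
    and r: "r > 0"
  shows "(\<integral>\<^sup>+ \<omega>. ennreal (expfun \<xi> \<omega> powr (r - 1)) \<partial>M) =
         ennreal (Gamma r * \<Phi> 1 powr (1 - r) *
           exp (- (LINT x:{0<..}|\<kappa>.
              (exp (- (r - 1) * x) - 1 - (r - 1) * (exp (- x) - 1)) / (x * (exp x - 1)))))"
proof -
  interpret subordinator_process M \<xi> using sub by unfold_locales
  interpret subordinator_exponent M \<xi> \<Phi> using Phi Phi_nz by unfold_locales auto
  interpret log_derivative_measure \<kappa> \<Phi> "deriv \<Phi>"
    using kappa_sets kappa_supp kappa_LT Phi_pos Phi_deriv Phi_deriv_nonneg Phi_deriv_le
    by unfold_locales auto
  define G where "G s = moment s * (\<Phi> 1 powr (s - 1) * exp (kernel_integral s))" for s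
  have P1: "0 < \<Phi> 1" using Phi_pos by simp
  have "G r = Gamma r"
  proof (rule Gamma_pos_real_unique[where G = G])
    show "G 1 = 1" using P1 by (simp add: G_def moment_1 kernel_integral_1)
    show "G (s + 1) = s * G s" if "0 < s" for s
    proof -
      have "exp (kernel_integral (s + 1)) = exp (kernel_integral s) * \<Phi> s / \<Phi> 1"
        using that P1 Phi_pos[OF that] by (simp add: kernel_integral_plus1 exp_add exp_diff)
      moreover have "\<Phi> 1 powr s = \<Phi> 1 powr (s - 1) * \<Phi> 1"
        using P1 by (simp add: powr_diff)
      ultimately show ?thesis
        using P1 Phi_pos[OF that] by (simp add: G_def moment_plus1[OF that])
    qed
    show "0 < G s" if "0 < s" for s
      using that P1 by (simp add: G_def expfun_moment_pos)
    \<comment> \<open>The power of \<open>\<Phi> 1\<close> contributes an affine term, so convexity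
      holds whatever the sign of \<open>ln (\<Phi> 1)\<close>.\<close>
    have conv: "convex_on {0<..} (\<lambda>s. ln (moment s) + ((s - 1) * ln (\<Phi> 1) + kernel_integral s))"
    proof (intro convex_on_add convex_on_ln_expfun_moment kernel_integral_convex)
      show "convex_on {0<..} (\<lambda>s. (s - 1) * ln (\<Phi> 1))"
        by (rule f''_ge0_imp_convex[where f' = "\<lambda>s. ln (\<Phi> 1)" and f'' = "\<lambda>s. 0"])
           (auto intro!: derivative_eq_intros simp: convex_real_interval)
    qed
    have eq: "(ln \<circ> G) s = ln (moment s) + ((s - 1) * ln (\<Phi> 1) + kernel_integral s)" if "s \<in> {0<..}" for s
      using that P1 expfun_moment_pos[of s] by (simp add: G_def ln_mult ln_powr)
    \<comment> \<open>The logarithm splits only at positive arguments, so convexity is transferred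
      at the three points involved and not by rewriting the function.\<close>
    show "convex_on {0<..} (ln \<circ> G)"
    proof (rule convex_onI)
      fix t x y :: real
      assume t: "0 < t" "t < 1" and xy: "x \<in> {0<..}" "y \<in> {0<..}"
      then have xyt: "(1 - t) *\<^sub>R x + t *\<^sub>R y \<in> {0<..}" by (simp add: add_pos_pos)
      show "(ln \<circ> G) ((1 - t) *\<^sub>R x + t *\<^sub>R y) \<le> (1 - t) * (ln \<circ> G) x + t * (ln \<circ> G) y"
        unfolding eq[OF xy(1)] eq[OF xy(2)] eq[OF xyt]
        using t xy by (intro convex_onD[OF conv]) auto
    qed (simp add: convex_real_interval)
  qed (rule r)
  then have "moment r = Gamma r * \<Phi> 1 powr (1 - r) * exp (- kernel_integral r)"
    using P1 by (simp add: G_def powr_diff exp_minus field_simps)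
  then show ?thesis
    using nn_integral_eq_moment[OF r] by (simp add: kernel_integral_def ratio_kernel_def)
qed

end
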